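(* Let $\alpha>0$ and let $F$ be a continuous distribution function supported on $[1,\infty)$ with $\overline{F}=1-F\in \mathrm{RV}_{-\alpha}$, and suppose that $\overline F$ and $F^{\leftarrow}$ are continuous. Let $(X_i)_{i\ge1}$ be i.i.d. with distribution function $F$, let $L(x)=x^{\alpha}\overline F(x)$, and let $$\mathcal U(x)=\frac{\alpha\int_0^{\overline F(x)}\log F^{\leftarrow}(1-s)\,ds-(\alpha\log x+1)\overline F(x)}{\int_0^{\overline F(x)}\log\frac{F^{\leftarrow}(1-s)}{x}\,ds}.$$ Then, for every $x\ge F^{\leftarrow}(0)$, $$D_{n,[\overline F(x)n]}\ \longrightarrow\ \sup_{y\ge1}y^{-\alpha}\Big|y^{\mathcal U(x)}-\frac{L(xy)}{L(x)}\Big|\quad\text{in probability as } n\to\infty.$$ Furthermore, for every $x\ge1$, $$\sup_{y\ge1}y^{-\alpha}\Big|y^{\mathcal U(x)}-\frac{L(xy)}{L(x)}\Big|>0,$$ unless $F$ is eventually Pareto. Consequently, $\kappa_n^\star/n\to0$ in probability as $n\to\infty$ unless $F$ is eventually Pareto.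
   Context: $\overline F\in\mathrm{RV}_{-\alpha}$ means $\lim_{t\to\infty}\overline F(tx)/\overline F(t)=x^{-\alpha}$ for every $x>0$; then $L$ is slowly varying. $F^{\leftarrow}(s)=\inf\{x\in(0,\infty):F(x)\ge s\}$ for $s\in(0,1)$, and $F^{\leftarrow}(0)=\lim_{s\downarrow0}F^{\leftarrow}(s)\ge1$ is the left endpoint of the support; continuity of $F^{\leftarrow}$ means continuity on $[0,1)$. $F$ is called eventually Pareto when there exist $x_0$ and $c>0$ such that $\overline F(x)=cx^{-\alpha}$ for all $x\ge x_0$. $X_{1:n}\le\dots\le X_{n:n}$ are the order statistics of $X_1,\dots,X_n$. For $1\le k\le n-1$, $$H_{n,k}=\frac1k\sum_{i=1}^k\log\frac{X_{n-k+i:n}}{X_{n-k:n}},\qquad \widehat\alpha_{n,k}=H_{n,k}^{-1},$$ $$D_{n,k}=\sup_{y\ge1}\Big|\frac1k\sum_{i=1}^k \mathbf 1_{(y,\infty)}\Big(\frac{X_{n-k+i:n}}{X_{n-k:n}}\Big)-y^{-\widehat\alpha_{n,k}}\Big|,$$ and $\kappa_n^\star=\operatorname{argmin}_{1\le k\le n-1}D_{n,k}$ (the smallest minimizer if it is not unique). $[u]$ denotes the integer part of $u$; when $[\overline F(x)n]=n$ (i.e. $x=F^{\leftarrow}(0)$) the index is understood as $n-1$, and $n$ is taken large enough that $[\overline F(x)n]\ge1$. *)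

theory Defs
  imports "HOL-Probability.Probability"
begin

section \<open>Regular variation, quantiles, and the limiting exponent\<close>

definition tail :: "(real \<Rightarrow> real) \<Rightarrow> real \<Rightarrow> real" where
  "tail F x = 1 - F x"

definition regularly_varying :: "(real \<Rightarrow> real) \<Rightarrow> real \<Rightarrow> bool" where
  "regularly_varying G \<rho> \<longleftrightarrow> (\<forall>x>0. ((\<lambda>t. G (t * x) / G t) \<longlongrightarrow> x powr \<rho>) at_top)"

text \<open>
  The value at \<open>s = 0\<close> is the right limit, i.e. the left endpoint of the support. Only
  arguments in \<open>[0,1)\<close> are meaningful; for \<open>s \<ge> 1\<close> the set may be empty.
\<close>
definition quantile :: "(real \<Rightarrow> real) \<Rightarrow> real \<Rightarrow> real" where
  "quantile F s =
     (if s = 0 then Lim (at_right 0) (\<lambda>u. Inf {x. 0 < x \<and> F x \<ge> u})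
      else Inf {x. 0 < x \<and> F x \<ge> s})"

definition slow_part :: "real \<Rightarrow> (real \<Rightarrow> real) \<Rightarrow> real \<Rightarrow> real" where
  "slow_part \<alpha> F x = x powr \<alpha> * tail F x"

definition limit_exponent :: "real \<Rightarrow> (real \<Rightarrow> real) \<Rightarrow> real \<Rightarrow> real" where
  "limit_exponent \<alpha> F x =
     (\<alpha> * (LBINT s:{0..tail F x}. ln (quantile F (1 - s))) - (\<alpha> * ln x + 1) * tail F x)
       / (LBINT s:{0..tail F x}. ln (quantile F (1 - s) / x))"

definition limit_distance :: "real \<Rightarrow> (real \<Rightarrow> real) \<Rightarrow> real \<Rightarrow> real" where
  "limit_distance \<alpha> F x =
     (SUP y\<in>{1..}. y powr (-\<alpha>) *
        \<bar>y powr limit_exponent \<alpha> F x - slow_part \<alpha> F (x * y) / slow_part \<alpha> F x\<bar>)"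

definition eventually_pareto :: "real \<Rightarrow> (real \<Rightarrow> real) \<Rightarrow> bool" where
  "eventually_pareto \<alpha> F \<longleftrightarrow> (\<exists>x0 c. c > 0 \<and> (\<forall>x\<ge>x0. tail F x = c * x powr (-\<alpha>)))"

section \<open>Sample quantities\<close>

text \<open>
  \<open>order_stat X n j \<omega>\<close> is the \<open>j\<close>-th smallest of \<open>X 1 \<omega>, \<dots>, X n \<omega>\<close>, for \<open>1 \<le> j \<le> n\<close>.
\<close>
definition order_stat :: "(nat \<Rightarrow> 'a \<Rightarrow> real) \<Rightarrow> nat \<Rightarrow> nat \<Rightarrow> 'a \<Rightarrow> real" where
  "order_stat X n j \<omega> = sort (map (\<lambda>i. X i \<omega>) [1..<Suc n]) ! (j - 1)"

definition hill :: "(nat \<Rightarrow> 'a \<Rightarrow> real) \<Rightarrow> nat \<Rightarrow> nat \<Rightarrow> 'a \<Rightarrow> real" where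
  "hill X n k \<omega> =
     1 / real k * (\<Sum>i=1..k. ln (order_stat X n (n - k + i) \<omega> / order_stat X n (n - k) \<omega>))"

definition hill_index :: "(nat \<Rightarrow> 'a \<Rightarrow> real) \<Rightarrow> nat \<Rightarrow> nat \<Rightarrow> 'a \<Rightarrow> real" where
  "hill_index X n k \<omega> = inverse (hill X n k \<omega>)"

definition KS_distance :: "(nat \<Rightarrow> 'a \<Rightarrow> real) \<Rightarrow> nat \<Rightarrow> nat \<Rightarrow> 'a \<Rightarrow> real" where
  "KS_distance X n k \<omega> =
     (SUP y\<in>{1..}.
        \<bar>1 / real k * (\<Sum>i=1..k. indicator {y<..}
            (order_stat X n (n - k + i) \<omega> / order_stat X n (n - k) \<omega>))
         - y powr (- hill_index X n k \<omega>)\<bar>)"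

definition KS_argmin :: "(nat \<Rightarrow> 'a \<Rightarrow> real) \<Rightarrow> nat \<Rightarrow> 'a \<Rightarrow> nat" where
  "KS_argmin X n \<omega> =
     (LEAST k. k \<in> {1..n - 1} \<and> (\<forall>j\<in>{1..n - 1}. KS_distance X n k \<omega> \<le> KS_distance X n j \<omega>))"

text \<open>
  The integer part of \<open>n\<close> times the tail of \<open>F\<close> at \<open>x\<close>, replaced by \<open>n - 1\<close> when it equals \<open>n\<close>.
\<close>
definition tail_index :: "(real \<Rightarrow> real) \<Rightarrow> real \<Rightarrow> nat \<Rightarrow> nat" where
  "tail_index F x n =
     (let k = nat \<lfloor>tail F x * real n\<rfloor> in if k = n then n - 1 else k)"

text \<open>
  Measurability is part of the definition, because \<^const>\<open>measure\<close> is \<open>0\<close> on non-measurable sets.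
\<close>
definition tendsto_in_prob :: "'a measure \<Rightarrow> (nat \<Rightarrow> 'a \<Rightarrow> real) \<Rightarrow> real \<Rightarrow> bool" where
  "tendsto_in_prob M Y c \<longleftrightarrow>
     (\<forall>n. Y n \<in> borel_measurable M) \<and>
     (\<forall>\<epsilon>>0. (\<lambda>n. measure M {\<omega> \<in> space M. \<bar>Y n \<omega> - c\<bar> > \<epsilon>}) \<longlonglongrightarrow> 0)"

end

theory Submission
  imports Defs "HOL-Real_Asymp.Real_Asymp"
begin

text \<open>
  Write \<open>G = 1 - F\<close> for the tail and \<open>\<phi>(t) = E (log X - log t)\<^sup>+\<close> for the mean log-excess over \<open>t\<close>.
  Since \<open>F\<^sup>\<leftarrow>(1 - s)\<close> has law \<open>F\<close> when \<open>s\<close> is uniform, both integrals in the limiting exponent are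
  expectations over the event \<open>X > x\<close>, and the exponent equals \<open>\<alpha> - G(x)/\<phi>(x)\<close>. Hence the limiting distance is
  \<open>d(x) = sup\<^sub>y |G(xy)/G(x) - y powr (-G(x)/\<phi>(x))|\<close>. It compares the law of \<open>X/x\<close> given \<open>X > x\<close> with the
  Pareto law whose index is the reciprocal of the mean of \<open>log (X/x)\<close> given \<open>X > x\<close>.

  The sample distance has the same shape. If \<open>T\<close> is the threshold \<open>X\<^sub>n\<^sub>-\<^sub>k\<^sub>:\<^sub>n\<close>, then \<open>D\<^sub>n\<^sub>,\<^sub>k\<close> is obtained from \<open>d(T)\<close>
  by replacing \<open>G\<close> and \<open>\<phi>\<close> with their empirical versions and \<open>G(T)\<close> with \<open>k/n\<close>
  (\<open>KS_distance_eq_sample_means\<close>). The weak law of large numbers gives convergence of the empirical \<open>G\<close> and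
  \<open>\<phi>\<close> at each point. Both are antitone with continuous limits, so pointwise convergence
  already allows evaluation at a moving argument (\<open>antitone_sandwich_tendsto\<close>) and
  becomes uniform (\<open>antitone_pointwise_imp_uniform\<close>). So \<open>D\<^sub>n\<^sub>,\<^sub>k\<close> tends to \<open>d(x)\<close> whenever the threshold tends
  to \<open>x\<close> (\<open>KS_functional_tendsto\<close>, \<open>KS_distance_tendsto\<close>). For \<open>k = [G(x) n]\<close> the threshold does tend to \<open>x\<close>, because
  continuity of the quantile function makes \<open>F\<close> strictly increasing on its support.

  If \<open>d(x) = 0\<close>, then \<open>G\<close> is a power on \<open>[x, \<infinity>)\<close>, and regular variation forces the exponent to be
  \<open>-\<alpha>\<close>; so \<open>F\<close> is eventually Pareto.

  For the argmin, \<open>k \<ge> \<epsilon>n\<close> confines the threshold to a compact interval \<open>[1, B]\<close>. Near each point \<open>x\<close> of it the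
  distance tends to \<open>d(x) > 0\<close>, so compactness bounds \<open>D\<^sub>n\<^sub>,\<^sub>k\<close> below by some \<open>\<delta> > 0\<close> for all these \<open>k\<close> at
  once (\<open>KS_distance_bounded_below\<close>). On the other hand Karamata's theorem \<open>\<phi>(x)/G(x) \<rightarrow> 1/\<alpha>\<close> gives \<open>d(x) \<rightarrow> 0\<close> as
  \<open>x \<rightarrow> \<infinity>\<close> (\<open>limit_distance_tendsto_0\<close>), so some fixed \<open>x\<close> has \<open>D\<close> below \<open>\<delta>\<close> at the index \<open>[G(x) n]\<close>. The minimizer
  must then be smaller than \<open>\<epsilon>n\<close>.

  Convergence in probability is treated throughout as convergence along the filter \<open>whp\<close>, for which a
  statement about \<open>(n, \<omega>)\<close> holds eventually if it fails only with vanishing probability. All limit arguments thereby become deterministic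
  statements about an arbitrary filter.
\<close>

section \<open>Convergence of antitone functions\<close>

text \<open>
  For fixed \<open>s < x < t\<close> eventually \<open>s < T i < t\<close>, so that \<open>p i\<close> lies between \<open>g i t\<close> and \<open>g i s\<close>; then \<open>s\<close> and \<open>t\<close>
  close up on \<open>x\<close> by continuity. Allowing any \<open>p\<close> between the one-sided values of \<open>g i\<close> at \<open>T i\<close>, and not only
  \<open>p i = g i (T i)\<close>, covers the ratio \<open>k/n\<close>, which may lie strictly between them when the empirical tail jumps at
  the threshold.
\<close>
lemma antitone_sandwich_tendsto:
  fixes g :: "'i \<Rightarrow> real \<Rightarrow> real"
  assumes x: "0 < x" and T: "(T \<longlongrightarrow> x) \<G>"
    and g: "\<And>t. 0 < t \<Longrightarrow> ((\<lambda>i. g i t) \<longlongrightarrow> G t) \<G>"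
    and cont: "isCont G x"
    and p: "\<forall>\<^sub>F i in \<G>. (\<forall>s\<in>{0<..<T i}. p i \<le> g i s) \<and> (\<forall>t>T i. g i t \<le> p i)"
  shows "(p \<longlongrightarrow> G x) \<G>"
proof (rule order_tendstoI)
  fix b assume "b < G x"
  then have "\<forall>\<^sub>F t in at_right x. b < G t"
    using cont by (intro order_tendstoD) (auto simp: isCont_def intro: tendsto_within_subset)
  moreover have "\<forall>\<^sub>F t in at_right x. x < t" by (rule eventually_at_right_less)
  ultimately have "\<forall>\<^sub>F t in at_right x. b < G t \<and> x < t" by eventually_elim simp
  then obtain t where t: "b < G t" "x < t"
    using eventually_happens' trivial_limit_at_right_real by blast
  have "\<forall>\<^sub>F i in \<G>. b < g i t" using g[of t] t x by (intro order_tendstoD) auto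
  moreover have "\<forall>\<^sub>F i in \<G>. T i < t" using T t by (intro order_tendstoD)
  ultimately show "\<forall>\<^sub>F i in \<G>. b < p i" using p
    by eventually_elim (use less_le_trans in blast)
next
  fix b assume "G x < b"
  then have "\<forall>\<^sub>F t in at_left x. G t < b"
    using cont by (intro order_tendstoD) (auto simp: isCont_def intro: tendsto_within_subset)
  moreover have "\<forall>\<^sub>F t in at_left x. t \<in> {0<..<x}" using x by (rule eventually_at_left_real)
  ultimately have "\<forall>\<^sub>F t in at_left x. G t < b \<and> t \<in> {0<..<x}" by eventually_elim simp
  then obtain t where t: "G t < b" "t < x" "0 < t"
    using eventually_happens' trivial_limit_at_left_real by fastforce
  have "\<forall>\<^sub>F i in \<G>. g i t < b" using g[of t] t x by (intro order_tendstoD) auto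
  moreover have "\<forall>\<^sub>F i in \<G>. t < T i" using T t by (intro order_tendstoD)
  ultimately show "\<forall>\<^sub>F i in \<G>. p i < b" using p
  proof eventually_elim
    case (elim i)
    then have "p i \<le> g i t" using t by simp
    then show ?case using elim by linarith
  qed
qed

text \<open>
  Polya's argument: an antitone function is controlled between two neighbouring grid points by its
  values there. On a bounded interval a grid fine enough for the uniform continuity of the limit suffices, and
  beyond that interval both functions are nonnegative and small. Thus finitely many points, where pointwise
  convergence is enough, control the supremum.
\<close>
lemma antitone_pointwise_imp_uniform:
  fixes u :: "'i \<Rightarrow> real \<Rightarrow> real" and v :: "real \<Rightarrow> real"
  assumes u: "\<forall>\<^sub>F i in \<G>. antimono_on {1..} (u i) \<and> (\<forall>y\<ge>1. 0 \<le> u i y)"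
    and v: "antimono_on {1..} v" "continuous_on {1..} v" "(v \<longlongrightarrow> 0) at_top"
    and lim: "\<And>y. 1 \<le> y \<Longrightarrow> ((\<lambda>i. u i y) \<longlongrightarrow> v y) \<G>"
  shows "uniform_limit {1..} u v \<G>"
  unfolding uniform_limit_iff
proof (intro allI impI)
  fix \<epsilon> :: real assume \<epsilon>: "0 < \<epsilon>"
  have "\<forall>\<^sub>F b in at_top. v b < \<epsilon>/2 \<and> 1 \<le> b"
    using order_tendstoD(2)[OF v(3), of "\<epsilon>/2"] eventually_ge_at_top[of "1::real"] \<epsilon>
    by (simp add: eventually_conj)
  then obtain b where b: "v b < \<epsilon>/2" "1 \<le> b"
    using eventually_happens' trivial_limit_at_top_linorder by blast
  have v0: "0 \<le> v y" if "1 \<le> y" for y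
  proof (rule tendsto_upperbound[OF v(3)])
    show "\<forall>\<^sub>F z in at_top. v z \<le> v y"
      using eventually_ge_at_top[of y]
      by eventually_elim (use that v(1) in \<open>auto simp: monotone_on_def\<close>)
  qed simp
  \<comment> \<open>The extra unit leaves room for the right end of the grid cell that contains \<open>b\<close>.\<close>
  have "uniformly_continuous_on {1..b+1} v"
    using v(2) by (intro compact_uniformly_continuous continuous_on_subset[OF v(2)]) auto
  then obtain d0 where d0: "0 < d0"
    "\<And>y z. y \<in> {1..b+1} \<Longrightarrow> z \<in> {1..b+1} \<Longrightarrow> dist z y < d0 \<Longrightarrow> dist (v z) (v y) < \<epsilon>/2"
    using \<epsilon> unfolding uniformly_continuous_on_def by (metis half_gt_zero)
  define d where "d = min (d0/2) 1"
  have d: "0 < d" "d < d0" "d \<le> 1" using d0(1) by (auto simp: d_def)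
  define N where "N = nat \<lceil>b / d\<rceil>"
  have "\<forall>\<^sub>F i in \<G>. \<forall>j\<in>{..N+1}. dist (u i (1 + j*d)) (v (1 + j*d)) < \<epsilon>/2"
    using \<epsilon> d(1) by (intro eventually_ball_finite ballI tendstoD[OF lim]) auto
  moreover have "\<forall>\<^sub>F i in \<G>. dist (u i b) (v b) < \<epsilon>/2"
    using b \<epsilon> by (intro tendstoD[OF lim]) auto
  ultimately show "\<forall>\<^sub>F i in \<G>. \<forall>y\<in>{1..}. dist (u i y) (v y) < \<epsilon>"
    using u
  proof eventually_elim
    case (elim i)
    have anti: "u i z \<le> u i y" if "1 \<le> y" "y \<le> z" for y z
      using elim(3) that by (auto simp: monotone_on_def)
    have antiv: "v z \<le> v y" if "1 \<le> y" "y \<le> z" for y z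
      using v(1) that by (auto simp: monotone_on_def)
    show ?case
    proof
      fix y :: real assume "y \<in> {1..}"
      then have y: "1 \<le> y" by simp
      show "dist (u i y) (v y) < \<epsilon>"
      proof (cases "b \<le> y")
        case True
        have "u i y \<le> u i b" "0 \<le> u i y" "v y \<le> v b" "0 \<le> v y"
          using anti[of b y] antiv[of b y] True b y v0 elim(3) by auto
        then show ?thesis using elim(2) b unfolding dist_real_def by linarith
      next
        case False
        define j where "j = nat \<lfloor>(y - 1) / d\<rfloor>"
        have jr: "real j = of_int \<lfloor>(y - 1) / d\<rfloor>" using y d by (simp add: j_def)
        have j1: "real j * d \<le> y - 1"
          using d(1) of_int_floor_le[of "(y-1)/d"] unfolding jr by (simp only: pos_le_divide_eq)
        have "(y - 1)/d < real j + 1" unfolding jr by linarith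
        then have j2: "y - 1 < (real j + 1) * d" using d(1) by (simp add: field_simps)
        have "(y - 1)/d \<le> b/d" using False y d by (intro divide_right_mono) auto
        then have "j \<le> N" unfolding j_def N_def by linarith
        then have gl: "dist (u i (1 + j*d)) (v (1 + j*d)) < \<epsilon>/2"
             "dist (u i (1 + Suc j*d)) (v (1 + Suc j*d)) < \<epsilon>/2"
          using elim(1) by force+
        have l: "1 \<le> 1 + j*d" "1 + j*d \<le> y" "y \<le> 1 + Suc j*d"
          using d j1 j2 by (auto simp: algebra_simps)
        have "1 + Suc j*d \<le> b + 1" using j1 False d by (simp add: algebra_simps)
        then have "dist (v (1 + j*d)) (v (1 + Suc j*d)) < \<epsilon>/2"
          using l d False by (intro d0(2)) (auto simp: dist_real_def algebra_simps)
        moreover have "v y \<le> v (1 + j*d)" "v (1 + Suc j*d) \<le> v y"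
             "u i y \<le> u i (1 + j*d)" "u i (1 + Suc j*d) \<le> u i y"
          using l y by (auto intro!: anti antiv)
        ultimately show ?thesis using gl unfolding dist_real_def by linarith
      qed
    qed
  qed
qed

text \<open>
  The supremum norm is 1-Lipschitz for uniform distance; the bound on \<open>w0\<close> keeps the suprema meaningful.
\<close>
lemma uniform_limit_imp_tendsto_SUP_abs:
  fixes w :: "'i \<Rightarrow> 'b \<Rightarrow> real"
  assumes unif: "uniform_limit S w w0 \<G>" and S: "S \<noteq> {}" and C: "\<And>y. y \<in> S \<Longrightarrow> \<bar>w0 y\<bar> \<le> C"
  shows "((\<lambda>i. SUP y\<in>S. \<bar>w i y\<bar>) \<longlongrightarrow> (SUP y\<in>S. \<bar>w0 y\<bar>)) \<G>"
proof (rule tendstoI)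
  fix \<epsilon> :: real assume \<epsilon>: "0 < \<epsilon>"
  have bdd0: "bdd_above ((\<lambda>y. \<bar>w0 y\<bar>) ` S)" using C by (auto simp: bdd_above_def)
  have "\<forall>\<^sub>F i in \<G>. \<forall>y\<in>S. dist (w i y) (w0 y) < \<epsilon>/2"
    using unif \<epsilon> unfolding uniform_limit_iff by (meson half_gt_zero)
  then show "\<forall>\<^sub>F i in \<G>. dist (SUP y\<in>S. \<bar>w i y\<bar>) (SUP y\<in>S. \<bar>w0 y\<bar>) < \<epsilon>"
  proof eventually_elim
    case (elim i)
    have near: "\<bar>w i y\<bar> \<le> \<bar>w0 y\<bar> + \<epsilon>/2" "\<bar>w0 y\<bar> \<le> \<bar>w i y\<bar> + \<epsilon>/2" if "y \<in> S" for y
      using elim[rule_format, OF that] unfolding dist_real_def by linarith+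
    have bdd: "bdd_above ((\<lambda>y. \<bar>w i y\<bar>) ` S)"
      using near(1) C by (intro bdd_aboveI2[of _ _ "C + \<epsilon>/2"]) force
    have "(SUP y\<in>S. \<bar>w i y\<bar>) \<le> (SUP y\<in>S. \<bar>w0 y\<bar>) + \<epsilon>/2"
      using S near(1) cSUP_upper[OF _ bdd0] by (intro cSUP_least) force+
    moreover have "(SUP y\<in>S. \<bar>w0 y\<bar>) \<le> (SUP y\<in>S. \<bar>w i y\<bar>) + \<epsilon>/2"
      using S near(2) cSUP_upper[OF _ bdd] by (intro cSUP_least) force+
    ultimately show ?case using \<epsilon> by (simp add: dist_real_def)
  qed
qed

lemma powr_minus_antimono_on: "0 \<le> a \<Longrightarrow> antimono_on {1..} (\<lambda>y::real. y powr (-a))"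
  by (auto intro!: monotone_onI powr_mono2')

text \<open>
  The Kolmogorov-Smirnov distance between a rescaled tail and a power law depends continuously on the
  tail, the threshold \<open>T\<close>, the normalization \<open>p\<close> and the mean log-excess ratio \<open>h\<close>. Both curves are antitone in \<open>y\<close> with a
  continuous limit vanishing at infinity, so their pointwise convergence is uniform.
\<close>
lemma KS_functional_tendsto:
  fixes g :: "'i \<Rightarrow> real \<Rightarrow> real"
  assumes x: "0 < x" and T: "(T \<longlongrightarrow> x) \<G>"
    and p: "(p \<longlongrightarrow> G x) \<G>" and h: "(h \<longlongrightarrow> b) \<G>" and b: "0 < b"
    and g: "\<forall>\<^sub>F i in \<G>. antimono_on {0<..} (g i) \<and> (\<forall>t>0. 0 \<le> g i t)"
    and gG: "\<And>t. 0 < t \<Longrightarrow> ((\<lambda>i. g i t) \<longlongrightarrow> G t) \<G>"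
    and G: "antimono_on {0<..} G" "continuous_on {0<..} G" "(G \<longlongrightarrow> 0) at_top" "0 < G x"
  shows "((\<lambda>i. SUP y\<in>{1..}. \<bar>g i (T i * y) / p i - y powr (- inverse (h i))\<bar>)
    \<longlongrightarrow> (SUP y\<in>{1..}. \<bar>G (x * y) / G x - y powr (- inverse b)\<bar>)) \<G>"
proof -
  have ev: "\<forall>\<^sub>F i in \<G>. 0 < T i" "\<forall>\<^sub>F i in \<G>. 0 < p i" "\<forall>\<^sub>F i in \<G>. 0 < h i"
    using order_tendstoD(1)[OF T x] order_tendstoD(1)[OF p G(4)] order_tendstoD(1)[OF h b] by auto
  have isCont: "isCont G t" if "0 < t" for t
    using G(2) that by (simp add: continuous_on_eq_continuous_at)
  have G0: "0 \<le> G y" if "0 < y" for y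
  proof (rule tendsto_upperbound[OF G(3)])
    show "\<forall>\<^sub>F z in at_top. G z \<le> G y"
      using eventually_ge_at_top[of y]
      by eventually_elim (use that G(1) in \<open>auto simp: monotone_on_def\<close>)
  qed simp
  have scaled: "filterlim (\<lambda>y. x * y) at_top at_top"
    using x by (intro filterlim_tendsto_pos_mult_at_top[OF tendsto_const]) (auto intro: filterlim_ident)
  have U: "uniform_limit {1..} (\<lambda>i y. g i (T i * y) / p i) (\<lambda>y. G (x * y) / G x) \<G>"
  proof (rule antitone_pointwise_imp_uniform)
    show "\<forall>\<^sub>F i in \<G>. antimono_on {1..} (\<lambda>y. g i (T i * y) / p i) \<and> (\<forall>y\<ge>1. 0 \<le> g i (T i * y) / p i)"
      using ev(1,2) g
    proof eventually_elim
      case (elim i)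
      then show ?case
        by (auto simp: monotone_on_def intro!: divide_right_mono)
    qed
    show "antimono_on {1..} (\<lambda>y. G (x * y) / G x)"
      using G(1,4) x by (auto simp: monotone_on_def intro!: divide_right_mono)
    show "continuous_on {1..} (\<lambda>y. G (x * y) / G x)"
      using G(4) x by (intro continuous_intros continuous_on_compose2[OF G(2)]) auto
    show "((\<lambda>y. G (x * y) / G x) \<longlongrightarrow> 0) at_top"
      using tendsto_divide[OF filterlim_compose[OF G(3) scaled] tendsto_const[of "G x"]] G(4) by simp
    fix y :: real assume y: "1 \<le> y"
    have "((\<lambda>i. g i (T i * y)) \<longlongrightarrow> G (x * y)) \<G>"
    proof (rule antitone_sandwich_tendsto[where T = "\<lambda>i. T i * y" and g = g and x = "x * y" and G = G])
      show "0 < x * y" using x y by simp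
      show "((\<lambda>i. T i * y) \<longlongrightarrow> x * y) \<G>" by (intro tendsto_intros T)
      show "isCont G (x * y)" using x y by (intro isCont) simp
      show "\<forall>\<^sub>F i in \<G>. (\<forall>s\<in>{0<..<T i * y}. g i (T i * y) \<le> g i s) \<and> (\<forall>t>T i * y. g i t \<le> g i (T i * y))"
        using ev(1) g
      proof eventually_elim
        case (elim i)
        then have "0 < T i * y" using y by simp
        then show ?case using elim(2) by (auto simp: monotone_on_def)
      qed
    qed (rule gG)
    then show "((\<lambda>i. g i (T i * y) / p i) \<longlongrightarrow> G (x * y) / G x) \<G>"
      using p G(4) by (intro tendsto_divide) auto
  qed
  have V: "uniform_limit {1..} (\<lambda>i y. y powr (- inverse (h i))) (\<lambda>y. y powr (- inverse b)) \<G>"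
  proof (rule antitone_pointwise_imp_uniform)
    show "\<forall>\<^sub>F i in \<G>. antimono_on {1..} (\<lambda>y::real. y powr - inverse (h i)) \<and> (\<forall>y\<ge>1. 0 \<le> y powr - inverse (h i))"
      using ev(3) by eventually_elim (auto intro!: powr_minus_antimono_on)
    show "antimono_on {1..} (\<lambda>y. y powr - inverse b)" using b by (intro powr_minus_antimono_on) auto
    show "((\<lambda>y. y powr - inverse b) \<longlongrightarrow> 0) at_top"
      using b by (intro tendsto_neg_powr filterlim_ident) auto
    show "((\<lambda>i. y powr - inverse (h i)) \<longlongrightarrow> y powr - inverse b) \<G>" if "1 \<le> y" for y :: real
      using b that by (intro tendsto_intros h) auto
  qed (auto intro!: continuous_intros)
  show ?thesis
  proof (rule uniform_limit_imp_tendsto_SUP_abs[OF uniform_limit_minus[OF U V]])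
    fix y :: real assume "y \<in> {1..}"
    then have y: "1 \<le> y" by simp
    have "0 \<le> G (x*y)" "G (x*y) \<le> G x" using y x G(1) by (auto simp: monotone_on_def intro!: G0)
    then have "0 \<le> G (x*y) / G x" "G (x*y) / G x \<le> 1" using G(4) by auto
    moreover have "y powr (- inverse b) \<le> 1"
      using monotone_onD[OF powr_minus_antimono_on[of "inverse b"], of 1 y] b y by simp
    ultimately show "\<bar>G (x * y) / G x - y powr - inverse b\<bar> \<le> 1"
      using powr_ge_zero[of y "- inverse b"] by linarith
  qed simp
qed

text \<open>
  Turns local lower bounds for \<open>D\<close>, valid when \<open>T\<close> is near a given point, into one valid wherever \<open>T\<close> lies in
  the compact set: finitely many neighbourhoods cover it, and the least of their bounds serves.
\<close>
lemma compact_eventually_lower_bound: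
  fixes T :: "'i \<Rightarrow> 'b::topological_space" and D :: "'i \<Rightarrow> real"
  assumes K: "compact K" and T: "\<forall>\<^sub>F i in \<H>. T i \<in> K"
    and local: "\<And>x. x \<in> K \<Longrightarrow> \<exists>\<delta>>0. \<forall>\<^sub>F i in inf \<H> (filtercomap T (nhds x)). \<delta> < D i"
  shows "\<exists>\<delta>>0. \<forall>\<^sub>F i in \<H>. \<delta> < D i"
proof -
  define good where "good U \<longleftrightarrow> (\<exists>\<delta>>0. \<forall>\<^sub>F i in \<H>. T i \<in> U \<longrightarrow> \<delta> < D i)" for U
  have "\<exists>U. open U \<and> good U \<and> x \<in> U" if x: "x \<in> K" for x
  proof -
    obtain \<delta> where \<delta>: "0 < \<delta>" "\<forall>\<^sub>F i in inf \<H> (filtercomap T (nhds x)). \<delta> < D i"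
      using local[OF x] by blast
    then obtain P Q where P: "eventually P \<H>" and Q: "eventually Q (filtercomap T (nhds x))"
        and PQ: "\<And>i. P i \<Longrightarrow> Q i \<Longrightarrow> \<delta> < D i"
      unfolding eventually_inf by blast
    obtain U where U: "open U" "x \<in> U" "\<And>i. T i \<in> U \<Longrightarrow> Q i"
      using Q unfolding eventually_filtercomap_nhds by blast
    have "\<forall>\<^sub>F i in \<H>. T i \<in> U \<longrightarrow> \<delta> < D i" using P by eventually_elim (use PQ U in blast)
    then show ?thesis using \<delta> U unfolding good_def by blast
  qed
  then have cover: "K \<subseteq> \<Union>{U. open U \<and> good U}" by blast
  obtain \<C> where \<C>: "\<C> \<subseteq> {U. open U \<and> good U}" "finite \<C>" "K \<subseteq> \<Union>\<C>"
    by (rule compactE[OF K cover]) simp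
  have "good (\<Union>\<C>)"
    using \<C>(2,1)
  proof (induction \<C> rule: finite_induct)
    case empty
    show ?case unfolding good_def by (intro exI[of _ 1]) simp
  next
    case (insert U \<C>)
    then obtain d e where de: "0 < d" "\<forall>\<^sub>F i in \<H>. T i \<in> U \<longrightarrow> d < D i"
        "0 < e" "\<forall>\<^sub>F i in \<H>. T i \<in> \<Union>\<C> \<longrightarrow> e < D i"
      unfolding good_def by auto
    from de(2,4) have "\<forall>\<^sub>F i in \<H>. T i \<in> \<Union>(insert U \<C>) \<longrightarrow> min d e < D i"
      by eventually_elim auto
    then show ?case unfolding good_def using de(1,3) by (intro exI[of _ "min d e"]) auto
  qed
  then obtain \<delta> where "0 < \<delta>" and \<delta>: "\<forall>\<^sub>F i in \<H>. T i \<in> \<Union>\<C> \<longrightarrow> \<delta> < D i"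
    unfolding good_def by blast
  from \<delta> T have "\<forall>\<^sub>F i in \<H>. \<delta> < D i" by eventually_elim (use \<C>(3) in auto)
  then show ?thesis using \<open>0 < \<delta>\<close> by blast
qed

section \<open>Karamata's relation between a tail and its logarithmic integral\<close>

text \<open>
  For \<open>\<phi>(x) = \<integral>\<^sub>x\<^sup>\<infinity> G(u)/u du\<close> this is Karamata's theorem. Only the increments of \<open>\<phi>\<close> matter: along
  \<open>x e\<^sup>h\<^sup>N\<close> they lie between \<open>h\<close> times consecutive values of \<open>G\<close>, and for large \<open>x\<close> regular variation compares these
  values with a geometric sequence whose ratio is near \<open>q = exp (-\<alpha> h)\<close>. Summation puts \<open>\<phi>(x)/G(x)\<close>
  asymptotically between \<open>h q/(1 - q)\<close> and \<open>h/(1 - q)\<close>, and both tend to \<open>1/\<alpha>\<close> as \<open>h \<rightarrow> 0\<close>.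
\<close>
lemma karamata_ratio_tendsto:
  fixes G \<phi> :: "real \<Rightarrow> real"
  assumes \<alpha>: "0 < \<alpha>" and rv: "regularly_varying G (-\<alpha>)"
    and G: "\<And>x. 0 < G x"
    and \<phi>: "(\<phi> \<longlongrightarrow> 0) at_top"
    and step: "\<And>x c. 0 < x \<Longrightarrow> 1 \<le> c \<Longrightarrow> ln c * G (x * c) \<le> \<phi> x - \<phi> (x * c) \<and> \<phi> x - \<phi> (x * c) \<le> ln c * G x"
  shows "((\<lambda>x. \<phi> x / G x) \<longlongrightarrow> 1 / \<alpha>) at_top"
proof -
  have ratio: "((\<lambda>t. G (t * exp h) / G t) \<longlongrightarrow> exp (- \<alpha> * h)) at_top" for h
    using rv[unfolded regularly_varying_def, rule_format, of "exp h"] by (simp add: powr_def)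
  have to_inf: "filterlim (\<lambda>N. x * exp h ^ N) at_top sequentially" if "0 < x" "0 < h" for x h :: real
    using that by real_asymp
  have upper: "\<forall>\<^sub>F x in at_top. \<phi> x / G x \<le> h / (1 - r)"
    if h: "0 < h" and r: "exp (- \<alpha> * h) < r" "r < 1" for h r
  proof -
    obtain x0 where x0: "\<And>t. t \<ge> x0 \<Longrightarrow> G (t * exp h) / G t < r"
      using order_tendstoD(2)[OF ratio r(1)] by (auto simp: eventually_at_top_linorder)
    have r0: "0 < r" using r(1) exp_gt_zero by (rule less_trans[rotated])
    show ?thesis using eventually_ge_at_top[of "max 1 x0"]
    proof eventually_elim
      case (elim x)
      then have x: "x \<ge> x0" "x \<ge> 1" by auto
      define z where "z N = x * exp h ^ N" for N
      have zS: "z (Suc N) = z N * exp h" for N by (simp add: z_def)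
      have zx: "x \<le> z N" for N using x h by (simp add: z_def)
      \<comment> \<open>All points \<open>x e\<^sup>h\<^sup>N\<close> lie beyond \<open>x0\<close>, so the bound on a single ratio iterates.\<close>
      have Gz: "G (z N) \<le> r ^ N * G x" for N
      proof (induction N)
        case (Suc N)
        have "G (z (Suc N)) \<le> r * G (z N)"
          using x0[of "z N"] zx[of N] x G[of "z N"] by (simp add: zS field_simps less_imp_le)
        also have "\<dots> \<le> r * (r ^ N * G x)" using Suc r0 by (intro mult_left_mono) auto
        finally show ?case by (simp add: mult_ac)
      qed (simp add: z_def)
      have "\<phi> x - \<phi> (z N) \<le> h * G x * (\<Sum>j<N. r ^ j)" for N
      proof (induction N)
        case (Suc N)
        have "\<phi> (z N) - \<phi> (z (Suc N)) \<le> h * G (z N)"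
          using step[of "z N" "exp h"] zx[of N] x h by (simp add: zS)
        also have "\<dots> \<le> h * (r ^ N * G x)" using Gz h by (intro mult_left_mono) auto
        finally show ?case using Suc by (simp add: algebra_simps)
      qed (simp add: z_def)
      moreover have "(\<lambda>N. \<phi> x - \<phi> (z N)) \<longlonglongrightarrow> \<phi> x - 0"
        unfolding z_def using x h
        by (intro tendsto_intros filterlim_compose[OF \<phi> to_inf]) auto
      moreover have "(\<lambda>N. h * G x * (\<Sum>j<N. r ^ j)) \<longlonglongrightarrow> h * G x * (1 / (1 - r))"
        using r r0 by (intro tendsto_intros geometric_sums[unfolded sums_def]) auto
      ultimately have "\<phi> x - 0 \<le> h * G x * (1 / (1 - r))"
        by (intro LIMSEQ_le) auto
      then show ?case using G[of x] r by (simp add: field_simps)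
    qed
  qed
  have lower: "\<forall>\<^sub>F x in at_top. h * r / (1 - r) \<le> \<phi> x / G x"
    if h: "0 < h" and r: "0 < r" "r < exp (- \<alpha> * h)" for h r
  proof -
    have "exp (- \<alpha> * h) < 1" using \<alpha> h by simp
    then have r1: "r < 1" using r by linarith
    obtain x0 where x0: "\<And>t. t \<ge> x0 \<Longrightarrow> r < G (t * exp h) / G t"
      using order_tendstoD(1)[OF ratio r(2)] by (auto simp: eventually_at_top_linorder)
    show ?thesis using eventually_ge_at_top[of "max 1 x0"]
    proof eventually_elim
      case (elim x)
      then have x: "x \<ge> x0" "x \<ge> 1" by auto
      define z where "z N = x * exp h ^ N" for N
      have zS: "z (Suc N) = z N * exp h" for N by (simp add: z_def)
      have zx: "x \<le> z N" for N using x h by (simp add: z_def)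
      have Gz: "r ^ N * G x \<le> G (z N)" for N
      proof (induction N)
        case (Suc N)
        have "r * (r ^ N * G x) \<le> r * G (z N)" using Suc r by (intro mult_left_mono) auto
        also have "\<dots> \<le> G (z (Suc N))"
          using x0[of "z N"] zx[of N] x G[of "z N"] by (simp add: zS field_simps less_imp_le)
        finally show ?case by (simp add: mult_ac)
      qed (simp add: z_def)
      have "h * G x * r * (\<Sum>j<N. r ^ j) \<le> \<phi> x - \<phi> (z N)" for N
      proof (induction N)
        case (Suc N)
        have "h * (r ^ Suc N * G x) \<le> h * G (z (Suc N))" using Gz[of "Suc N"] h by (intro mult_left_mono) auto
        also have "\<dots> \<le> \<phi> (z N) - \<phi> (z (Suc N))"
          using step[of "z N" "exp h"] zx[of N] x h by (simp add: zS)
        finally show ?case using Suc by (simp add: algebra_simps)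
      qed (simp add: z_def)
      moreover have "(\<lambda>N. \<phi> x - \<phi> (z N)) \<longlonglongrightarrow> \<phi> x - 0"
        unfolding z_def using x h
        by (intro tendsto_intros filterlim_compose[OF \<phi> to_inf]) auto
      moreover have "(\<lambda>N. h * G x * r * (\<Sum>j<N. r ^ j)) \<longlonglongrightarrow> h * G x * r * (1 / (1 - r))"
        using r r1 by (intro tendsto_intros geometric_sums[unfolded sums_def]) auto
      ultimately have "h * G x * r * (1 / (1 - r)) \<le> \<phi> x - 0"
        by (intro LIMSEQ_le) auto
      then show ?case using G[of x] r1 by (simp add: field_simps)
    qed
  qed
  have lim_up: "((\<lambda>h. h / (1 - exp (-\<alpha> * h))) \<longlongrightarrow> 1 / \<alpha>) (at_right 0)"
    using \<alpha> by (real_asymp simp: field_simps)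
  have lim_lo: "((\<lambda>h. h * exp (-\<alpha> * h) / (1 - exp (-\<alpha> * h))) \<longlongrightarrow> 1 / \<alpha>) (at_right 0)"
    using \<alpha> by (real_asymp simp: field_simps)
  have pos: "\<forall>\<^sub>F h in at_right 0. (0::real) < h" by (rule eventually_at_right_less)
  show ?thesis
  proof (rule order_tendstoI)
    fix a assume "1 / \<alpha> < a"
    then have "\<forall>\<^sub>F h in at_right 0. h / (1 - exp (-\<alpha> * h)) < a \<and> 0 < h"
      using order_tendstoD(2)[OF lim_up] pos by (simp add: eventually_conj)
    then obtain h where h: "h / (1 - exp (-\<alpha> * h)) < a" "0 < h"
      using eventually_happens' trivial_limit_at_right_real by blast
    define q where "q = exp (-\<alpha> * h)"
    have q: "0 < q" "q < 1" using \<alpha> h by (auto simp: q_def)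
    have "((\<lambda>r. h / (1 - r)) \<longlongrightarrow> h / (1 - q)) (at_right q)" using q by (intro tendsto_intros) auto
    then have "\<forall>\<^sub>F r in at_right q. h / (1 - r) < a" using h(1) by (intro order_tendstoD) (auto simp: q_def)
    moreover have "\<forall>\<^sub>F r in at_right q. r \<in> {q<..<1}" using q by (intro eventually_at_right_real)
    ultimately have "\<forall>\<^sub>F r in at_right q. h / (1 - r) < a \<and> r \<in> {q<..<1}" by (rule eventually_conj)
    then obtain r where r: "h / (1 - r) < a" "q < r" "r < 1"
      using eventually_happens' trivial_limit_at_right_real by fastforce
    show "\<forall>\<^sub>F x in at_top. \<phi> x / G x < a"
      using upper[OF h(2), of r] r by (auto simp: q_def elim!: eventually_mono)
  next
    fix a assume "a < 1 / \<alpha>"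
    then have "\<forall>\<^sub>F h in at_right 0. a < h * exp (-\<alpha> * h) / (1 - exp (-\<alpha> * h)) \<and> 0 < h"
      using order_tendstoD(1)[OF lim_lo] pos by (simp add: eventually_conj)
    then obtain h where h: "a < h * exp (-\<alpha> * h) / (1 - exp (-\<alpha> * h))" "0 < h"
      using eventually_happens' trivial_limit_at_right_real by blast
    define q where "q = exp (-\<alpha> * h)"
    have q: "0 < q" "q < 1" using \<alpha> h by (auto simp: q_def)
    have "((\<lambda>r. h * r / (1 - r)) \<longlongrightarrow> h * q / (1 - q)) (at_left q)" using q by (intro tendsto_intros) auto
    then have "\<forall>\<^sub>F r in at_left q. a < h * r / (1 - r)" using h(1) by (intro order_tendstoD) (auto simp: q_def)
    moreover have "\<forall>\<^sub>F r in at_left q. r \<in> {0<..<q}" using q by (intro eventually_at_left_real)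
    ultimately have "\<forall>\<^sub>F r in at_left q. a < h * r / (1 - r) \<and> r \<in> {0<..<q}" by (rule eventually_conj)
    then obtain r where r: "a < h * r / (1 - r)" "0 < r" "r < q"
      using eventually_happens' trivial_limit_at_left_real by fastforce
    show "\<forall>\<^sub>F x in at_top. a < \<phi> x / G x"
      using lower[OF h(2), of r] r by (auto simp: q_def elim!: eventually_mono)
  qed
qed

section \<open>Sample means and log-excesses\<close>

definition sample_mean :: "(nat \<Rightarrow> 'a \<Rightarrow> real) \<Rightarrow> nat \<Rightarrow> (real \<Rightarrow> real) \<Rightarrow> 'a \<Rightarrow> real" where
  "sample_mean X n f \<omega> = (\<Sum>j=1..n. f (X j \<omega>)) / real n"

lemma sample_mean_mono:
  "(\<And>v. f v \<le> g v) \<Longrightarrow> sample_mean X n f \<omega> \<le> sample_mean X n g \<omega>"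
  unfolding sample_mean_def by (intro divide_right_mono sum_mono) auto

lemma sample_mean_nonneg: "(\<And>v. 0 \<le> f v) \<Longrightarrow> 0 \<le> sample_mean X n f \<omega>"
  unfolding sample_mean_def by (intro divide_nonneg_nonneg sum_nonneg) auto

text \<open>
  The positive part of \<open>log v - log t\<close> for positive \<open>v\<close>. It is defined by cases because \<open>ln\<close> is extended to negative
  reals as an even function; with cases it vanishes for every \<open>v \<le> t\<close> and is antitone in \<open>t > 0\<close> whatever the sign of \<open>v\<close>.
\<close>
definition log_excess :: "real \<Rightarrow> real \<Rightarrow> real" where
  "log_excess t v = (if v \<le> t then 0 else ln (v / t))"

lemma log_excess_nonneg: "0 < t \<Longrightarrow> 0 \<le> log_excess t v"
  by (simp add: log_excess_def)

lemma borel_measurable_log_excess [measurable]: "log_excess t \<in> borel_measurable borel"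
  unfolding log_excess_def[abs_def] by measurable

lemma log_excess_step:
  assumes "0 < x" "1 \<le> c"
  shows "ln c * indicator {x * c<..} v \<le> log_excess x v - log_excess (x * c) v"
    and "log_excess x v - log_excess (x * c) v \<le> ln c * indicator {x<..} v"
proof -
  have xc: "x \<le> x * c" using assms by simp
  consider "v \<le> x" | "x < v" "v \<le> x * c" | "x * c < v" by linarith
  then have "ln c * indicator {x * c<..} v \<le> log_excess x v - log_excess (x * c) v \<and>
      log_excess x v - log_excess (x * c) v \<le> ln c * indicator {x<..} v"
  proof cases
    case 1
    then show ?thesis using xc by (simp add: log_excess_def)
  next
    case 2
    then have "v / x \<le> c" using assms by (simp add: field_simps)
    then have "ln (v / x) \<le> ln c" using 2 assms by (subst ln_le_cancel_iff) auto
    then show ?thesis using 2 xc assms by (simp add: log_excess_def)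
  next
    case 3
    have "0 < v" using 3 xc assms by linarith
    then have "ln (v / x) - ln (v / (x * c)) = ln c" using assms by (simp add: ln_div ln_mult)
    moreover have "x < v" using 3 xc by linarith
    ultimately show ?thesis using 3 by (simp add: log_excess_def)
  qed
  then show "ln c * indicator {x * c<..} v \<le> log_excess x v - log_excess (x * c) v"
    and "log_excess x v - log_excess (x * c) v \<le> ln c * indicator {x<..} v" by auto
qed

lemma log_excess_antimono: "antimono_on {0<..} (\<lambda>t. log_excess t v)"
proof (rule monotone_onI)
  fix s t :: real assume "s \<in> {0<..}" "t \<in> {0<..}" "s \<le> t"
  then have st: "0 < s" "1 \<le> t / s" "t = s * (t / s)" by auto
  have "0 \<le> ln (t / s) * indicator {s * (t / s)<..} v" using st(2) by (intro mult_nonneg_nonneg) auto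
  also have "\<dots> \<le> log_excess s v - log_excess (s * (t / s)) v" using st by (intro log_excess_step) auto
  finally show "log_excess t v \<le> log_excess s v" using st by simp
qed

text \<open>
  The squares are telescoped as \<open>m\<^sup>2 = 1 + 3 + \<dots> + (2m - 1)\<close>, where \<open>m\<close> is the log-excess rounded up and the \<open>j\<close>-th odd number is
  present iff \<open>v > t e\<^sup>j\<close>. So tail probabilities bound the second moment.
\<close>
lemma log_excess_square_le_suminf:
  assumes t: "0 < t"
  shows "ennreal ((log_excess t v)\<^sup>2) \<le> (\<Sum>j. ennreal (2 * real j + 1) * indicator {t * exp (real j)<..} v)"
proof -
  define m where "m = nat \<lceil>log_excess t v\<rceil>"
  have odd_sum: "(\<Sum>j<n. 2 * real j + 1) = (real n)\<^sup>2" for n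
    by (induction n) (auto simp: power2_eq_square algebra_simps)
  have exceeds: "indicator {t * exp (real j)<..} v = (1::ennreal)" if "j < m" for j
  proof -
    have j: "real j < log_excess t v" using that unfolding m_def by linarith
    then have "t < v" "real j < ln (v / t)" by (auto simp: log_excess_def split: if_splits)
    then have "exp (real j) < v / t" using t by (metis divide_pos_pos exp_less_cancel_iff exp_ln less_trans)
    then show ?thesis using t by (simp add: field_simps)
  qed
  have "ennreal ((log_excess t v)\<^sup>2) \<le> ennreal ((real m)\<^sup>2)"
    using log_excess_nonneg[OF t, of v] by (intro ennreal_leI power_mono) (auto simp: m_def real_nat_ceiling_ge)
  also have "\<dots> = (\<Sum>j<m. ennreal (2 * real j + 1))" unfolding odd_sum[symmetric] by (rule sum_ennreal[symmetric]) simp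
  also have "\<dots> = (\<Sum>j<m. ennreal (2 * real j + 1) * indicator {t * exp (real j)<..} v)"
    by (intro sum.cong refl) (simp only: exceeds lessThan_iff mult_1_right)
  also have "\<dots> \<le> (\<Sum>j. ennreal (2 * real j + 1) * indicator {t * exp (real j)<..} v)"
    by (intro sum_le_suminf) auto
  finally show ?thesis .
qed

section \<open>Order statistics\<close>

lemma order_stat_mono:
  assumes "1 \<le> i" "i \<le> j" "j \<le> n"
  shows "order_stat X n i \<omega> \<le> order_stat X n j \<omega>"
  unfolding order_stat_def using assms by (intro sorted_nth_mono) auto

lemma sum_order_stat:
  fixes f :: "real \<Rightarrow> real"
  shows "(\<Sum>j=1..n. f (order_stat X n j \<omega>)) = (\<Sum>j=1..n. f (X j \<omega>))"
proof -
  define xs where "xs = map (\<lambda>i. X i \<omega>) [1..<Suc n]"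
  have "(\<Sum>j=1..n. f (order_stat X n j \<omega>)) = (\<Sum>j=0..<n. f (sort xs ! j))"
    by (rule sum.reindex_bij_witness[of _ Suc "\<lambda>j. j - 1"]) (auto simp: order_stat_def xs_def)
  also have "\<dots> = sum_list (map f (sort xs))"
    by (simp add: sum_list_sum_nth xs_def)
  also have "\<dots> = sum_list (map f xs)"
    by (metis mset_map mset_sort sum_mset_sum_list)
  also have "\<dots> = (\<Sum>j=1..n. f (X j \<omega>))"
    by (simp add: xs_def o_def interv_sum_list_conv_sum_set_nat atLeastLessThanSuc_atLeastAtMost del: upt_Suc)
  finally show ?thesis .
qed

text \<open>
  Sums over the top \<open>k\<close> order statistics become sums over the whole unordered sample, provided that the summand vanishes up to
  the threshold. Ties with the threshold do no harm.
\<close>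
lemma sum_top_order_stat:
  fixes f :: "real \<Rightarrow> real"
  assumes k: "1 \<le> k" "k < n" and f: "\<And>v. v \<le> order_stat X n (n - k) \<omega> \<Longrightarrow> f v = 0"
  shows "(\<Sum>i=1..k. f (order_stat X n (n - k + i) \<omega>)) = (\<Sum>j=1..n. f (X j \<omega>))"
proof -
  have "(\<Sum>i=1..k. f (order_stat X n (n - k + i) \<omega>)) = (\<Sum>j\<in>{n-k+1..n}. f (order_stat X n j \<omega>))"
    using k by (intro sum.reindex_bij_witness[of _ "\<lambda>j. j - (n - k)" "\<lambda>i. n - k + i"]) auto
  also have "\<dots> = (\<Sum>j=1..n. f (order_stat X n j \<omega>))"
    using k by (intro sum.mono_neutral_left) (auto intro!: f order_stat_mono)
  finally show ?thesis by (simp only: sum_order_stat)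
qed

text \<open>
  Together these say that \<open>k/n\<close> lies between the left limit and the value of the empirical tail at the threshold, which
  is how \<open>k\<close> and the threshold determine each other asymptotically.
\<close>
lemma order_stat_threshold:
  assumes k: "1 \<le> k" "k < n"
  shows "s < order_stat X n (n - k) \<omega> \<Longrightarrow> real k / real n \<le> sample_mean X n (indicator {s<..}) \<omega>"
    and "order_stat X n (n - k) \<omega> \<le> t \<Longrightarrow> sample_mean X n (indicator {t<..}) \<omega> \<le> real k / real n"
proof -
  let ?T = "order_stat X n (n - k) \<omega>"
  assume s: "s < ?T"
  have "s < order_stat X n j \<omega>" if "j \<in> {n-k+1..n}" for j
  proof -
    have "?T \<le> order_stat X n j \<omega>" using that k by (intro order_stat_mono) auto
    then show ?thesis using s by simp
  qed
  then have "real k = (\<Sum>j\<in>{n-k+1..n}. indicator {s<..} (order_stat X n j \<omega>))"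
    using k by simp
  also have "\<dots> \<le> (\<Sum>j=1..n. indicator {s<..} (order_stat X n j \<omega>))"
    by (intro sum_mono2) auto
  finally show "real k / real n \<le> sample_mean X n (indicator {s<..}) \<omega>"
    unfolding sum_order_stat sample_mean_def by (intro divide_right_mono) auto
next
  assume t: "order_stat X n (n - k) \<omega> \<le> t"
  have "(\<Sum>j=1..n. indicator {t<..} (X j \<omega>)) =
      (\<Sum>i=1..k. indicator {t<..} (order_stat X n (n - k + i) \<omega>) :: real)"
    using t k by (intro sum_top_order_stat[symmetric]) auto
  also have "\<dots> \<le> (\<Sum>i=1..k. 1)" by (intro sum_mono) (auto simp: indicator_def)
  finally show "sample_mean X n (indicator {t<..}) \<omega> \<le> real k / real n"
    unfolding sample_mean_def by (intro divide_right_mono) auto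
qed

text \<open>
  Both the empirical tail of the rescaled excesses and the Hill estimate are averages over the top \<open>k\<close> observations of
  functions that vanish up to the threshold. So the order statistics enter only through the threshold \<open>T\<close>.
\<close>
lemma KS_distance_eq_sample_means:
  assumes k: "1 \<le> k" "k < n" and T: "0 < order_stat X n (n - k) \<omega>"
  defines "T \<equiv> order_stat X n (n - k) \<omega>"
  shows "KS_distance X n k \<omega> = (SUP y\<in>{1..}.
      \<bar>sample_mean X n (indicator {T * y<..}) \<omega> / (real k / real n)
       - y powr (- inverse (sample_mean X n (log_excess T) \<omega> / (real k / real n)))\<bar>)"
proof -
  have T0: "0 < T" using T by (simp add: T_def)
  have ge: "T \<le> order_stat X n (n - k + i) \<omega>" if "i \<in> {1..k}" for i
    using that k unfolding T_def by (intro order_stat_mono) auto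
  have "hill X n k \<omega> = 1 / real k * (\<Sum>i=1..k. log_excess T (order_stat X n (n - k + i) \<omega>))"
    unfolding hill_def T_def[symmetric]
  proof (intro arg_cong2[where f = "(*)"] refl sum.cong)
    fix i assume "i \<in> {1..k}"
    from ge[OF this] T0 show "ln (order_stat X n (n - k + i) \<omega> / T) = log_excess T (order_stat X n (n - k + i) \<omega>)"
      by (auto simp: log_excess_def)
  qed
  also have "\<dots> = 1 / real k * (\<Sum>j=1..n. log_excess T (X j \<omega>))"
    by (subst sum_top_order_stat[OF k]) (auto simp: log_excess_def T_def)
  finally have hill: "hill X n k \<omega> = sample_mean X n (log_excess T) \<omega> / (real k / real n)"
    using k by (simp add: sample_mean_def)
  have tail: "1 / real k * (\<Sum>i=1..k. indicator {y<..} (order_stat X n (n - k + i) \<omega> / T))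
      = sample_mean X n (indicator {T * y<..}) \<omega> / (real k / real n)" if "1 \<le> y" for y
  proof -
    have "indicator {y<..} (v / T) = (indicator {T * y<..} v :: real)" for v
      using T0 by (auto simp: indicator_def field_simps)
    then have "(\<Sum>i=1..k. indicator {y<..} (order_stat X n (n - k + i) \<omega> / T)) =
        (\<Sum>i=1..k. indicator {T * y<..} (order_stat X n (n - k + i) \<omega>) :: real)" by simp
    also have "\<dots> = (\<Sum>j=1..n. indicator {T * y<..} (X j \<omega>))"
    proof (rule sum_top_order_stat[OF k])
      fix v assume "v \<le> order_stat X n (n - k) \<omega>"
      then have "v \<le> T * 1" by (simp add: T_def)
      also have "\<dots> \<le> T * y" using T0 that by (intro mult_left_mono) auto
      finally show "indicator {T * y<..} v = (0 :: real)" by simp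
    qed
    finally show ?thesis using k by (simp add: sample_mean_def)
  qed
  show ?thesis
    unfolding KS_distance_def hill_index_def hill T_def[symmetric]
    by (intro SUP_cong refl) (simp only: tail atLeast_iff)
qed

lemma order_stat_ge:
  assumes j: "1 \<le> j" "j \<le> n" and X: "\<And>i. i \<in> {1..n} \<Longrightarrow> a \<le> X i \<omega>"
  shows "a \<le> order_stat X n j \<omega>"
proof -
  have "order_stat X n j \<omega> \<in> set (sort (map (\<lambda>i. X i \<omega>) [1..<Suc n]))"
    unfolding order_stat_def using j by (intro nth_mem) auto
  then obtain i where "i \<in> set [1..<Suc n]" "order_stat X n j \<omega> = X i \<omega>"
    unfolding set_sort set_map by (rule imageE)
  then show ?thesis using X[of i] by (auto simp del: upt_Suc)
qed

lemma KS_argmin_bounds: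
  assumes "2 \<le> n"
  shows "KS_argmin X n \<omega> \<in> {1..n - 1}"
    and "j \<in> {1..n - 1} \<Longrightarrow> KS_distance X n (KS_argmin X n \<omega>) \<omega> \<le> KS_distance X n j \<omega>"
proof -
  let ?P = "\<lambda>k. k \<in> {1..n - 1} \<and> (\<forall>j\<in>{1..n - 1}. KS_distance X n k \<omega> \<le> KS_distance X n j \<omega>)"
  have "{1..n - 1} \<noteq> {}" using assms by simp
  then have "\<exists>k. ?P k"
    using ex_is_arg_min_if_finite[of "{1..n - 1}" "\<lambda>k. KS_distance X n k \<omega>"]
    by (simp add: is_arg_min_linorder Ball_def)
  then have "?P (KS_argmin X n \<omega>)" unfolding KS_argmin_def by (rule LeastI_ex)
  then show "KS_argmin X n \<omega> \<in> {1..n - 1}"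
    and "j \<in> {1..n - 1} \<Longrightarrow> KS_distance X n (KS_argmin X n \<omega>) \<omega> \<le> KS_distance X n j \<omega>" by blast+
qed

section \<open>Measurability of the sample quantities\<close>

text \<open>
  The \<open>j\<close>-th smallest observation is at most \<open>t\<close> iff at least \<open>j\<close> observations are.
\<close>
lemma borel_measurable_order_stat:
  assumes X: "\<And>i. i \<in> {1..n} \<Longrightarrow> X i \<in> borel_measurable M" and j: "1 \<le> j" "j \<le> n"
  shows "order_stat X n j \<in> borel_measurable M"
  unfolding borel_measurable_iff_le
proof
  fix t :: real
  have "order_stat X n j \<omega> \<le> t \<longleftrightarrow> real j \<le> (\<Sum>i=1..n. indicator {..t} (X i \<omega>))" for \<omega>
  proof
    assume le: "order_stat X n j \<omega> \<le> t"
    have "order_stat X n i \<omega> \<le> t" if "i \<in> {1..j}" for i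
      using order_stat_mono[of i j n X \<omega>] that j le by auto
    then have "real j = (\<Sum>i=1..j. indicator {..t} (order_stat X n i \<omega>))" by simp
    also have "\<dots> \<le> (\<Sum>i=1..n. indicator {..t} (order_stat X n i \<omega>))"
      using j by (intro sum_mono2) auto
    finally show "real j \<le> (\<Sum>i=1..n. indicator {..t} (X i \<omega>))" by (simp only: sum_order_stat)
  next
    assume ge: "real j \<le> (\<Sum>i=1..n. indicator {..t} (X i \<omega>))"
    show "order_stat X n j \<omega> \<le> t"
    proof (rule ccontr)
      assume gt: "\<not> order_stat X n j \<omega> \<le> t"
      have gt': "\<not> order_stat X n i \<omega> \<le> t" if "i \<in> {j..n}" for i
        using order_stat_mono[of j i n X \<omega>] that j gt by auto
      have "(\<Sum>i=1..n. indicator {..t} (X i \<omega>)) = (\<Sum>i=1..n. indicator {..t} (order_stat X n i \<omega>) :: real)"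
        by (simp only: sum_order_stat)
      also have "\<dots> = (\<Sum>i\<in>{1..<j}. indicator {..t} (order_stat X n i \<omega>))"
        using j gt' by (intro sum.mono_neutral_right) auto
      also have "\<dots> \<le> (\<Sum>i\<in>{1..<j}. 1)" by (intro sum_mono) (auto simp: indicator_def)
      also have "\<dots> < real j" using j by simp
      finally show False using ge by simp
    qed
  qed
  then have "{\<omega> \<in> space M. order_stat X n j \<omega> \<le> t} =
      {\<omega> \<in> space M. real j \<le> (\<Sum>i=1..n. indicator {..t} (X i \<omega>))}" by simp
  also have "\<dots> \<in> sets M"
    using X by measurable
  finally show "{\<omega> \<in> space M. order_stat X n j \<omega> \<le> t} \<in> sets M" .
qed

text \<open>
  Reduces the uncountable supremum in the distance to a countable one; indicators \<open>1\<^bsub>(y,\<infinity>)\<^esub>\<close> are right-continuous but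
  not continuous in \<open>y\<close>.
\<close>
lemma cSUP_right_continuous_eq_rational:
  fixes f :: "real \<Rightarrow> real"
  assumes bdd: "bdd_above (f ` {1..})" and rc: "\<And>y. 1 \<le> y \<Longrightarrow> (f \<longlongrightarrow> f y) (at_right y)"
  shows "(SUP y\<in>{1..}. f y) = (SUP y\<in>\<rat> \<inter> {1..}. f y)"
proof (rule antisym)
  have bdd': "bdd_above (f ` (\<rat> \<inter> {1..}))" by (rule bdd_above_mono[OF bdd]) auto
  show "(SUP y\<in>{1..}. f y) \<le> (SUP y\<in>\<rat> \<inter> {1..}. f y)"
  proof (rule cSUP_least)
    fix y :: real assume "y \<in> {1..}"
    then have y: "1 \<le> y" by simp
    show "f y \<le> (SUP y\<in>\<rat> \<inter> {1..}. f y)"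
    proof (rule ccontr)
      assume "\<not> ?thesis"
      then have "\<forall>\<^sub>F z in at_right y. (SUP y\<in>\<rat> \<inter> {1..}. f y) < f z"
        using rc[OF y] by (intro order_tendstoD) auto
      then obtain b where b: "y < b" "\<And>z. y < z \<Longrightarrow> z < b \<Longrightarrow> (SUP y\<in>\<rat> \<inter> {1..}. f y) < f z"
        unfolding eventually_at_right_field by blast
      obtain q where q: "q \<in> \<rat>" "y < q" "q < b" using Rats_dense_in_real[OF b(1)] by blast
      have "f q \<le> (SUP y\<in>\<rat> \<inter> {1..}. f y)"
        using q y by (intro cSUP_upper[OF _ bdd']) auto
      then show False using b(2)[OF q(2,3)] by simp
    qed
  qed simp
  show "(SUP y\<in>\<rat> \<inter> {1..}. f y) \<le> (SUP y\<in>{1..}. f y)"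
    by (intro cSUP_subset_mono bdd) (auto intro: exI[of _ 1])
qed

text \<open>
  The supremum of an unbounded set of reals is a value about which nothing is known, but it is the least
  element of an empty set and hence the same value for every unbounded set.
\<close>
lemma real_Sup_unbounded:
  fixes A :: "real set"
  assumes "\<not> bdd_above A"
  shows "Sup A = Sup UNIV"
proof -
  have "(\<forall>x\<in>A. x \<le> z) \<longleftrightarrow> (\<forall>x\<in>UNIV. x \<le> z)" for z
    using assms gt_ex[of z] by (auto simp: bdd_above_def not_le[symmetric])
  then show ?thesis unfolding Sup_real_def by simp
qed

text \<open>
  Nothing restricts the sign of the observations, so the Hill estimate may be negative on some event. There the
  supremum is over an unbounded set and thus constant; elsewhere it is bounded and agrees with a countable supremum.
\<close>
lemma borel_measurable_KS_distance:
  assumes X: "\<And>i. i \<in> {1..n} \<Longrightarrow> X i \<in> borel_measurable M" and k: "k = 0 \<or> k < n"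
  shows "KS_distance X n k \<in> borel_measurable M"
proof -
  define R where "R i \<omega> = order_stat X n (n - k + i) \<omega> / order_stat X n (n - k) \<omega>" for i \<omega>
  have R: "R i \<in> borel_measurable M" if "i \<in> {1..k}" for i
    unfolding R_def using that k by (intro borel_measurable_divide borel_measurable_order_stat X) auto
  define e where "e y \<omega> = 1 / real k * (\<Sum>i=1..k. indicator {y<..} (R i \<omega>))" for y \<omega>
  have e_meas: "e y \<in> borel_measurable M" for y
    unfolding e_def using R by measurable
  have e: "0 \<le> e y \<omega>" "e y \<omega> \<le> 1" for y \<omega>
  proof -
    show "0 \<le> e y \<omega>" unfolding e_def by (intro mult_nonneg_nonneg sum_nonneg) auto
    have "(\<Sum>i=1..k. indicator {y<..} (R i \<omega>)) \<le> (\<Sum>i=1..k. 1 :: real)"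
      by (intro sum_mono) (auto simp: indicator_def)
    then show "e y \<omega> \<le> 1" by (cases "k = 0") (auto simp: e_def divide_simps)
  qed
  define a where "a = hill_index X n k"
  have a_meas: "a \<in> borel_measurable M"
    unfolding a_def hill_index_def hill_def using R unfolding R_def by measurable
  define f where "f y \<omega> = \<bar>e y \<omega> - y powr (- max 0 (a \<omega>))\<bar>" for y \<omega>
  have f1: "f y \<omega> \<le> 1" if "1 \<le> y" for y \<omega>
  proof -
    have "y powr (- max 0 (a \<omega>)) \<le> y powr 0" using that by (intro powr_mono) auto
    then have "y powr (- max 0 (a \<omega>)) \<le> 1" using that by simp
    then show ?thesis using e[of y \<omega>] powr_ge_zero[of y "- max 0 (a \<omega>)"] unfolding f_def by linarith
  qed
  have bdd: "bdd_above ((\<lambda>y. f y \<omega>) ` {1..})" for \<omega>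
    using f1 by (intro bdd_aboveI2[of _ _ 1]) auto
  \<comment> \<open>On the event \<open>a \<omega> \<ge> 0\<close> the cut-off exponent in \<open>f\<close> is the true one; the cut-off keeps \<open>f\<close> bounded everywhere.\<close>
  have "KS_distance X n k \<omega> = (if a \<omega> < 0 then Sup UNIV else SUP y\<in>\<rat> \<inter> {1..}. f y \<omega>)" for \<omega>
  proof (cases "a \<omega> < 0")
    case True
    have "\<not> bdd_above ((\<lambda>y. \<bar>e y \<omega> - y powr (- a \<omega>)\<bar>) ` {1..})"
    proof
      assume "bdd_above ((\<lambda>y. \<bar>e y \<omega> - y powr (- a \<omega>)\<bar>) ` {1..})"
      then obtain C where C: "\<And>y. 1 \<le> y \<Longrightarrow> \<bar>e y \<omega> - y powr (- a \<omega>)\<bar> \<le> C"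
        by (auto simp: bdd_above_def)
      have "filterlim (\<lambda>y::real. y powr (- a \<omega>)) at_top at_top"
        using True by real_asymp
      then have "\<forall>\<^sub>F y::real in at_top. C + 1 < y powr (- a \<omega>) \<and> 1 \<le> y"
        using eventually_ge_at_top[of "1::real"] by (simp add: eventually_conj filterlim_at_top_dense)
      then obtain y where "C + 1 < y powr (- a \<omega>)" "1 \<le> y"
        using eventually_happens' trivial_limit_at_top_linorder by blast
      then show False using C[of y] e[of y \<omega>] by auto
    qed
    then show ?thesis using True
      unfolding KS_distance_def a_def[symmetric] R_def[symmetric] e_def[symmetric]
      by (simp add: real_Sup_unbounded)
  next
    case False
    have "KS_distance X n k \<omega> = (SUP y\<in>{1..}. f y \<omega>)"
      using False unfolding KS_distance_def a_def[symmetric] R_def[symmetric] e_def[symmetric] f_def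
      by (simp add: max_def)
    also have "\<dots> = (SUP y\<in>\<rat> \<inter> {1..}. f y \<omega>)"
    proof (rule cSUP_right_continuous_eq_rational[OF bdd])
      fix y :: real assume y: "1 \<le> y"
      have ind: "((\<lambda>z. indicator {z<..} r) \<longlongrightarrow> (indicator {y<..} r :: real)) (at_right y)" for r :: real
      proof (rule tendsto_eventually)
        show "\<forall>\<^sub>F z in at_right y. indicator {z<..} r = (indicator {y<..} r :: real)"
        proof (cases "y < r")
          case True
          then show ?thesis
            unfolding eventually_at_right_field by (intro exI[of _ r]) (auto simp: indicator_def)
        next
          case False
          then show ?thesis
            unfolding eventually_at_right_field by (intro exI[of _ "y + 1"]) (auto simp: indicator_def)
        qed
      qed
      show "((\<lambda>y. f y \<omega>) \<longlongrightarrow> f y \<omega>) (at_right y)"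
        unfolding f_def e_def using y by (intro tendsto_intros ind) auto
    qed
    finally show ?thesis using False by simp
  qed
  then have "KS_distance X n k = (\<lambda>\<omega>. if a \<omega> < 0 then Sup UNIV else SUP y\<in>\<rat> \<inter> {1..}. f y \<omega>)"
    by (rule ext)
  moreover have "f y \<in> borel_measurable M" for y
    unfolding f_def using e_meas a_meas by measurable
  then have "(\<lambda>\<omega>. SUP y\<in>\<rat> \<inter> {1..}. f y \<omega>) \<in> borel_measurable M"
    by (intro borel_measurable_cSUP countable_Int1 countable_rat bdd_above_mono[OF bdd]) auto
  ultimately show ?thesis using a_meas by simp
qed

lemma borel_measurable_KS_argmin:
  assumes X: "\<And>i. i \<in> {1..n} \<Longrightarrow> X i \<in> borel_measurable M"
  shows "(\<lambda>\<omega>. real (KS_argmin X n \<omega>) / real n) \<in> borel_measurable M"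
proof -
  have "KS_argmin X n \<in> measurable M (count_space UNIV)"
    unfolding KS_argmin_def
  proof (rule measurable_Least)
    fix k
    show "(\<lambda>\<omega>. k \<in> {1..n - 1} \<and> (\<forall>j\<in>{1..n - 1}. KS_distance X n k \<omega> \<le> KS_distance X n j \<omega>))
        \<in> measurable M (count_space UNIV)"
    proof (cases "k \<in> {1..n - 1}")
      case True
      have KS: "KS_distance X n j \<in> borel_measurable M" if "j \<in> {1..n - 1}" for j
        using that by (intro borel_measurable_KS_distance X) auto
      have "{\<omega> \<in> space M. KS_distance X n k \<omega> \<le> KS_distance X n j \<omega>} \<in> sets M" if "j \<in> {1..n - 1}" for j
        using KS[OF True] KS[OF that] by (rule borel_measurable_le)
      then have "{\<omega> \<in> space M. \<forall>j\<in>{1..n - 1}. KS_distance X n k \<omega> \<le> KS_distance X n j \<omega>} \<in> sets M"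
        by (intro sets.sets_Collect_finite_All) auto
      then show ?thesis using True by (simp add: pred_def)
    next
      case False
      then have "(\<lambda>\<omega>. k \<in> {1..n - 1} \<and> (\<forall>j\<in>{1..n - 1}. KS_distance X n k \<omega> \<le> KS_distance X n j \<omega>)) = (\<lambda>\<omega>. False)"
        by blast
      then show ?thesis by (simp only: measurable_const UNIV_I space_count_space)
    qed
  qed
  then show ?thesis by measurable
qed

section \<open>Convergence in probability as convergence along a filter\<close>

text \<open>
  A property of \<open>(n, \<omega>)\<close> holds eventually along this filter if it holds with high probability, that is, outside
  measurable events whose probabilities tend to 0. Convergence in probability is convergence along this filter, so
  the limit calculus for filters serves as continuous mapping theorem and as Slutsky's lemma.
\<close>
definition whp :: "'a measure \<Rightarrow> (nat \<times> 'a) filter" where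
  "whp M = Abs_filter (\<lambda>P. \<exists>B. (\<forall>n. B n \<in> sets M) \<and> (\<lambda>n. measure M (B n)) \<longlonglongrightarrow> 0 \<and>
     (\<forall>n. \<forall>\<omega>\<in>space M - B n. P (n, \<omega>)))"

lemma eventually_whp:
  "eventually P (whp M) \<longleftrightarrow> (\<exists>B. (\<forall>n. B n \<in> sets M) \<and> (\<lambda>n. measure M (B n)) \<longlonglongrightarrow> 0 \<and>
     (\<forall>n. \<forall>\<omega>\<in>space M - B n. P (n, \<omega>)))"
  unfolding whp_def
proof (rule eventually_Abs_filter, rule is_filter.intro, goal_cases)
  case 1
  then show ?case by (intro exI[of _ "\<lambda>_. {}"]) auto
next
  case (2 P Q)
  then obtain A B where AB: "\<And>n. A n \<in> sets M" "(\<lambda>n. measure M (A n)) \<longlonglongrightarrow> 0"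
      "\<forall>n. \<forall>\<omega>\<in>space M - A n. P (n, \<omega>)" "\<And>n. B n \<in> sets M" "(\<lambda>n. measure M (B n)) \<longlonglongrightarrow> 0"
      "\<forall>n. \<forall>\<omega>\<in>space M - B n. Q (n, \<omega>)" by metis
  have "(\<lambda>n. measure M (A n \<union> B n)) \<longlonglongrightarrow> 0"
  proof (rule tendsto_sandwich[OF _ _ tendsto_const])
    show "(\<lambda>n. measure M (A n) + measure M (B n)) \<longlonglongrightarrow> 0"
      using tendsto_add[OF AB(2,5)] by simp
    show "\<forall>\<^sub>F n in sequentially. measure M (A n \<union> B n) \<le> measure M (A n) + measure M (B n)"
      using AB(1,4) by (intro always_eventually allI measure_Un_le)
  qed simp
  then show ?case using AB by (intro exI[of _ "\<lambda>n. A n \<union> B n"]) auto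
next
  case (3 P Q)
  then show ?case by blast
qed

lemma tendsto_in_prob_iff_whp:
  assumes "prob_space M" and Y: "\<And>n. Y n \<in> borel_measurable M"
  shows "tendsto_in_prob M Y c \<longleftrightarrow> ((\<lambda>(n, \<omega>). Y n \<omega>) \<longlongrightarrow> c) (whp M)"
proof
  interpret prob_space M by fact
  assume L: "tendsto_in_prob M Y c"
  show "((\<lambda>(n, \<omega>). Y n \<omega>) \<longlongrightarrow> c) (whp M)"
  proof (rule tendstoI)
    fix e :: real assume e: "0 < e"
    then have "(\<lambda>n. measure M {\<omega> \<in> space M. \<bar>Y n \<omega> - c\<bar> > e/2}) \<longlonglongrightarrow> 0"
      using L half_gt_zero unfolding tendsto_in_prob_def by blast
    then show "\<forall>\<^sub>F z in whp M. dist (case z of (n, \<omega>) \<Rightarrow> Y n \<omega>) c < e"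
      unfolding eventually_whp using e Y
      by (intro exI[of _ "\<lambda>n. {\<omega> \<in> space M. \<bar>Y n \<omega> - c\<bar> > e/2}"]) (auto simp: dist_real_def)
  qed
next
  interpret prob_space M by fact
  assume R: "((\<lambda>(n, \<omega>). Y n \<omega>) \<longlongrightarrow> c) (whp M)"
  show "tendsto_in_prob M Y c"
    unfolding tendsto_in_prob_def
  proof (intro conjI allI impI Y)
    fix e :: real assume "0 < e"
    from tendstoD[OF R this] obtain B where B: "\<And>n. B n \<in> sets M" "(\<lambda>n. measure M (B n)) \<longlonglongrightarrow> 0"
      "\<And>n \<omega>. \<omega> \<in> space M - B n \<Longrightarrow> dist (Y n \<omega>) c < e"
      unfolding eventually_whp by auto
    have "{\<omega> \<in> space M. \<bar>Y n \<omega> - c\<bar> > e} \<subseteq> B n" for n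
      using B(3)[of _ n] by (force simp: dist_real_def)
    then show "(\<lambda>n. measure M {\<omega> \<in> space M. \<bar>Y n \<omega> - c\<bar> > e}) \<longlonglongrightarrow> 0"
      by (intro tendsto_sandwich[OF _ _ tendsto_const B(2)] always_eventually allI finite_measure_mono B(1)) auto
  qed
qed

lemma eventually_whp_of_sequentially:
  assumes "eventually P sequentially"
  shows "\<forall>\<^sub>F (n, \<omega>) in whp M. P n"
proof -
  from assms obtain N where N: "\<And>n. N \<le> n \<Longrightarrow> P n" by (auto simp: eventually_sequentially)
  let ?B = "\<lambda>n. if N \<le> n then {} else space M"
  have "(\<lambda>n. measure M (?B n)) \<longlonglongrightarrow> 0"
    by (rule tendsto_eventually) (auto simp: eventually_sequentially)
  then show ?thesis unfolding eventually_whp using N by (intro exI[of _ ?B]) auto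
qed

lemma tendsto_whp_of_sequentially: "Y \<longlonglongrightarrow> c \<Longrightarrow> ((\<lambda>(n, \<omega>). Y n) \<longlongrightarrow> c) (whp M)"
  unfolding tendsto_def
proof (intro allI impI)
  fix S assume "\<forall>S. open S \<longrightarrow> c \<in> S \<longrightarrow> (\<forall>\<^sub>F n in sequentially. Y n \<in> S)" "open S" "c \<in> S"
  then have "\<forall>\<^sub>F n in sequentially. Y n \<in> S" by blast
  from eventually_whp_of_sequentially[OF this, of M]
  show "\<forall>\<^sub>F z in whp M. (case z of (n, \<omega>) \<Rightarrow> Y n) \<in> S" by (simp add: case_prod_unfold)
qed

lemma eventually_whp_of_AE:
  assumes "\<And>n. AE \<omega> in M. P n \<omega>"
  shows "\<forall>\<^sub>F (n, \<omega>) in whp M. P n \<omega>"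
proof -
  have "\<exists>N. {\<omega> \<in> space M. \<not> P n \<omega>} \<subseteq> N \<and> N \<in> null_sets M" for n
    using assms[of n] by (auto elim!: AE_E)
  then obtain B where B: "\<And>n. {\<omega> \<in> space M. \<not> P n \<omega>} \<subseteq> B n" "\<And>n. B n \<in> null_sets M" by metis
  have "measure M (B n) = 0" for n using B(2)[of n] by (simp add: measure_def null_setsD1)
  then show ?thesis unfolding eventually_whp using B by (intro exI[of _ B]) (auto simp: null_setsD2[OF B(2)])
qed

text \<open>
  Bienayme's identity. Each new summand is independent of the sum of the others, so the cross term vanishes.
\<close>
lemma (in prob_space) expectation_square_sum_indep:
  fixes Y :: "'i \<Rightarrow> 'a \<Rightarrow> real"
  assumes "finite I" and "indep_vars (\<lambda>_. borel) Y I"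
    and "\<And>i. i \<in> I \<Longrightarrow> integrable M (\<lambda>\<omega>. (Y i \<omega>)\<^sup>2)" and "\<And>i. i \<in> I \<Longrightarrow> expectation (Y i) = 0"
  shows "integrable M (\<lambda>\<omega>. (\<Sum>i\<in>I. Y i \<omega>)\<^sup>2) \<and>
    expectation (\<lambda>\<omega>. (\<Sum>i\<in>I. Y i \<omega>)\<^sup>2) = (\<Sum>i\<in>I. expectation (\<lambda>\<omega>. (Y i \<omega>)\<^sup>2))"
  using assms
proof (induction I rule: finite_induct)
  case (insert i I)
  have ind: "indep_vars (\<lambda>_. borel) Y I" using insert.prems(1) by (rule indep_vars_subset) auto
  have rv: "Y j \<in> borel_measurable M" if "j \<in> insert i I" for j
    using insert.prems(1) that unfolding indep_vars_def by blast
  have int: "integrable M (Y j)" if "j \<in> insert i I" for j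
    using square_integrable_imp_integrable[OF rv[OF that] insert.prems(2)[OF that]] .
  let ?S = "\<lambda>\<omega>. \<Sum>j\<in>I. Y j \<omega>"
  note IH = insert.IH[OF ind insert.prems(2,3)]
  have iv: "indep_var borel (Y i) borel ?S" using insert by (intro indep_vars_sum)
  have intS: "integrable M ?S" using int by simp
  have cross: "integrable M (\<lambda>\<omega>. Y i \<omega> * ?S \<omega>)" "expectation (\<lambda>\<omega>. Y i \<omega> * ?S \<omega>) = 0"
    using indep_var_integrable[OF iv] indep_var_lebesgue_integral[OF iv] int intS insert.prems(3) by auto
  have "(\<lambda>\<omega>. (\<Sum>j\<in>insert i I. Y j \<omega>)\<^sup>2) = (\<lambda>\<omega>. (Y i \<omega>)\<^sup>2 + 2 * (Y i \<omega> * ?S \<omega>) + (?S \<omega>)\<^sup>2)"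
    using insert.hyps by (auto simp: power2_eq_square algebra_simps)
  then show ?case using IH cross insert.hyps insert.prems(2) by simp
qed simp

text \<open>
  Chebyshev's inequality applied to the sum of the centred observations, whose variance grows only linearly in \<open>n\<close>.
\<close>
lemma (in prob_space) weak_law_of_large_numbers:
  fixes X :: "nat \<Rightarrow> 'a \<Rightarrow> real"
  assumes indep: "indep_vars (\<lambda>_. borel) X {1..}" and dist: "\<And>i. 1 \<le> i \<Longrightarrow> distr M borel (X i) = \<nu>"
    and f: "f \<in> borel_measurable borel" and sq: "integrable \<nu> (\<lambda>v. (f v)\<^sup>2)"
  shows "((\<lambda>(n, \<omega>). sample_mean X n f \<omega>) \<longlongrightarrow> (\<integral>v. f v \<partial>\<nu>)) (whp M)"
proof -
  have X: "X i \<in> borel_measurable M" if "1 \<le> i" for i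
    using indep that unfolding indep_vars_def by auto
  have X': "(\<lambda>\<omega>. f (X i \<omega>)) \<in> borel_measurable M" if "1 \<le> i" for i
    using measurable_compose[OF X[OF that] f] .
  define \<mu> where "\<mu> = (\<integral>v. f v \<partial>\<nu>)"
  define \<sigma> where "\<sigma> = expectation (\<lambda>\<omega>. (f (X 1 \<omega>) - \<mu>)\<^sup>2)"
  have int_sq: "integrable M (\<lambda>\<omega>. (f (X i \<omega>))\<^sup>2)" if "1 \<le> i" for i
    using sq f X[OF that] unfolding dist[OF that, symmetric] by (subst (asm) integrable_distr_eq) auto
  have int: "integrable M (\<lambda>\<omega>. f (X i \<omega>))" if "1 \<le> i" for i
    using square_integrable_imp_integrable[OF X'[OF that] int_sq[OF that]] .
  have mean: "expectation (\<lambda>\<omega>. f (X i \<omega>)) = \<mu>" if "1 \<le> i" for i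
    unfolding \<mu>_def using f X[OF that] unfolding dist[OF that, symmetric] by (subst integral_distr) auto
  define Y where "Y i \<omega> = f (X i \<omega>) - \<mu>" for i \<omega>
  have Y_sq: "integrable M (\<lambda>\<omega>. (Y i \<omega>)\<^sup>2)" if "1 \<le> i" for i
    using int_sq[OF that] int[OF that] by (simp add: Y_def power2_diff)
  have Y_var: "expectation (\<lambda>\<omega>. (Y i \<omega>)\<^sup>2) = \<sigma>" if "1 \<le> i" for i
  proof -
    have "expectation (\<lambda>\<omega>. (f (X i \<omega>) - \<mu>)\<^sup>2) = (\<integral>v. (f v - \<mu>)\<^sup>2 \<partial>\<nu>)" if "1 \<le> i" for i
      using f X[OF that] unfolding dist[OF that, symmetric] by (subst integral_distr) auto
    from this[OF that] this[of 1] show ?thesis by (simp add: Y_def \<sigma>_def)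
  qed
  have Y_ind: "indep_vars (\<lambda>_. borel) Y {1..n}" for n
    unfolding Y_def using f
    by (intro indep_vars_compose2[OF indep_vars_subset[OF indep], where Y="\<lambda>_ v. f v - \<mu>"]) auto
  have Y_mean: "expectation (Y i) = 0" if "1 \<le> i" for i
    using int[OF that] mean[OF that] by (simp add: Y_def[abs_def] prob_space)
  have sum: "integrable M (\<lambda>\<omega>. (\<Sum>i=1..n. Y i \<omega>)\<^sup>2)"
     "expectation (\<lambda>\<omega>. (\<Sum>i=1..n. Y i \<omega>)\<^sup>2) = real n * \<sigma>" for n
    using expectation_square_sum_indep[OF _ Y_ind[of n]] Y_sq Y_var Y_mean by auto
  have meas: "sample_mean X n f \<in> borel_measurable M" for n
    unfolding sample_mean_def using X' by (intro borel_measurable_divide borel_measurable_sum) auto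
  have "tendsto_in_prob M (\<lambda>n. sample_mean X n f) \<mu>"
    unfolding tendsto_in_prob_def
  proof (intro conjI allI impI meas)
    fix e :: real assume e: "0 < e"
    have bound: "prob {\<omega> \<in> space M. \<bar>sample_mean X n f \<omega> - \<mu>\<bar> > e} \<le> \<sigma> / (real n * e\<^sup>2)" if n: "1 \<le> n" for n
    proof -
      have S: "(\<Sum>i=1..n. Y i \<omega>) = real n * (sample_mean X n f \<omega> - \<mu>)" for \<omega>
        using n by (simp add: Y_def sample_mean_def sum_subtractf field_simps)
      have "prob {\<omega> \<in> space M. \<bar>sample_mean X n f \<omega> - \<mu>\<bar> > e} \<le>
          prob {\<omega> \<in> space M. real n * e \<le> \<bar>\<Sum>i=1..n. Y i \<omega>\<bar>}"
      proof (rule finite_measure_mono)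
        show "{\<omega> \<in> space M. real n * e \<le> \<bar>\<Sum>i=1..n. Y i \<omega>\<bar>} \<in> sets M"
          unfolding S using meas by measurable
        show "{\<omega> \<in> space M. e < \<bar>sample_mean X n f \<omega> - \<mu>\<bar>} \<subseteq> {\<omega> \<in> space M. real n * e \<le> \<bar>\<Sum>i=1..n. Y i \<omega>\<bar>}"
          unfolding S using n by (auto simp: abs_mult)
      qed
      also have "\<dots> \<le> real n * \<sigma> / (real n * e)\<^sup>2"
        unfolding sum(2)[of n, symmetric]
      proof (rule second_moment_method)
        show "(\<lambda>\<omega>. \<Sum>i=1..n. Y i \<omega>) \<in> borel_measurable M" unfolding S using meas by measurable
      qed (use n e sum(1)[of n] in auto)
      also have "\<dots> = \<sigma> / (real n * e\<^sup>2)" using n by (simp add: power2_eq_square)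
      finally show ?thesis .
    qed
    show "(\<lambda>n. prob {\<omega> \<in> space M. \<bar>sample_mean X n f \<omega> - \<mu>\<bar> > e}) \<longlonglongrightarrow> 0"
    proof (rule tendsto_sandwich[OF _ _ tendsto_const])
      show "(\<lambda>n. \<sigma> / (real n * e\<^sup>2)) \<longlonglongrightarrow> 0" using e by real_asymp
      show "\<forall>\<^sub>F n in sequentially. prob {\<omega> \<in> space M. \<bar>sample_mean X n f \<omega> - \<mu>\<bar> > e} \<le> \<sigma> / (real n * e\<^sup>2)"
        using eventually_ge_at_top[of 1] by eventually_elim (rule bound)
    qed auto
  qed
  then show ?thesis
    unfolding \<mu>_def using tendsto_in_prob_iff_whp[OF prob_space_axioms meas] by simp
qed

section \<open>The limiting distance of a law with regularly varying tail\<close>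

locale heavy_tailed_law = real_distribution \<nu> for \<nu> :: "real measure" +
  fixes F :: "real \<Rightarrow> real" and \<alpha> :: real
  assumes F_def: "F = cdf \<nu>" and \<alpha>_pos: "0 < \<alpha>"
    and support: "measure \<nu> {1..} = 1"
    and F_cont: "continuous_on UNIV F"
    and tail_rv: "regularly_varying (tail F) (- \<alpha>)"
    and quantile_cont: "continuous_on {0..<1} (quantile F)"
begin

sublocale cdf_distribution \<nu> ..

abbreviation left_endpoint :: real where "left_endpoint \<equiv> quantile F 0"

definition mean_log_excess :: "real \<Rightarrow> real" where
  "mean_log_excess t = (\<integral>v. log_excess t v \<partial>\<nu>)"

lemma F_nonneg: "0 \<le> F x" and F_le_1: "F x \<le> 1"
  unfolding F_def by (rule cdf_nonneg, rule cdf_bounded_prob)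

lemma F_eq_prob: "F x = prob {..x}"
  by (simp only: F_def cdf_def)

lemma F_mono: "x \<le> y \<Longrightarrow> F x \<le> F y"
  unfolding F_def by (rule cdf_nondecreasing)

lemma isCont_F: "isCont F x"
  using F_cont by (simp add: continuous_on_eq_continuous_at)

text \<open>
  Continuity is needed at the point 1 itself, which \<open>{1..}\<close> contains.
\<close>
lemma F_eq_0: "x \<le> 1 \<Longrightarrow> F x = 0"
proof -
  have less: "F x = 0" if "x < 1" for x
  proof -
    have "prob ({..x} \<union> {1..}) = prob {..x} + prob {1..}"
      using that by (intro finite_measure_Union) auto
    then have "prob {..x} \<le> 0" using support prob_le_1[of "{..x} \<union> {1..}"] by linarith
    then show ?thesis using measure_nonneg[of \<nu> "{..x}"] by (simp add: F_def cdf_def)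
  qed
  have "(F \<longlongrightarrow> F 1) (at_left 1)" using isCont_F[of 1] by (auto simp: isCont_def intro: tendsto_within_subset)
  moreover have "\<forall>\<^sub>F x in at_left 1. F x = 0"
    using eventually_at_left_real[OF zero_less_one] by eventually_elim (simp add: less)
  then have "(F \<longlongrightarrow> 0) (at_left 1)" by (rule tendsto_eventually)
  ultimately have "F 1 = 0" by (rule tendsto_unique[OF trivial_limit_at_left_real])
  then show "x \<le> 1 \<Longrightarrow> F x = 0" using less by (cases "x = 1") auto
qed

lemma tail_antimono: "antimono_on S (tail F)"
  by (auto intro!: monotone_onI simp: tail_def F_mono)

lemma isCont_tail: "isCont (tail F) x"
  unfolding tail_def[abs_def] by (intro continuous_intros isCont_F)

lemma tail_cont: "continuous_on S (tail F)"
  by (intro continuous_at_imp_continuous_on ballI isCont_tail)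

lemma tail_le_1: "tail F x \<le> 1"
  using F_nonneg by (simp add: tail_def)

lemma tail_tendsto_0: "(tail F \<longlongrightarrow> 0) at_top"
  unfolding tail_def[abs_def] F_def using tendsto_diff[OF tendsto_const cdf_lim_at_top_prob, of 1] by simp

text \<open>
  If the tail vanished somewhere, all ratios further out would be \<open>0/0 = 0\<close>, whereas regular variation at \<open>x = 1\<close> requires
  the limit 1.
\<close>
lemma tail_pos: "0 < tail F x"
proof (rule ccontr)
  assume "\<not> 0 < tail F x"
  then have zero: "tail F t = 0" if "x \<le> t" for t
    using F_mono[OF that] F_le_1[of t] by (simp add: tail_def)
  have "((\<lambda>t. tail F (t * 1) / tail F t) \<longlongrightarrow> 1 powr (- \<alpha>)) at_top"
    using tail_rv unfolding regularly_varying_def by (metis zero_less_one)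
  moreover have "\<forall>\<^sub>F t in at_top. tail F (t * 1) / tail F t = 0"
    using eventually_ge_at_top[of x] by eventually_elim (simp add: zero)
  then have "((\<lambda>t. tail F (t * 1) / tail F t) \<longlongrightarrow> 0) at_top" by (rule tendsto_eventually)
  ultimately have "1 powr (- \<alpha>) = 0" by (rule tendsto_unique[OF trivial_limit_at_top_linorder])
  then show False by simp
qed

lemma prob_greaterThan: "prob {x<..} = tail F x"
proof -
  have "{x<..} = space \<nu> - {..x}" by auto
  then show ?thesis using prob_compl[of "{..x}"] by (simp add: tail_def F_def cdf_def)
qed

lemma integrable_indicator_greaterThan: "integrable \<nu> (indicator {x<..} :: real \<Rightarrow> real)"
  by (intro integrable_real_indicator) (simp_all add: less_top[symmetric])

lemma tail_ratio_tendsto: "0 < y \<Longrightarrow> ((\<lambda>t. tail F (t * y) / tail F t) \<longlongrightarrow> y powr (- \<alpha>)) at_top"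
  using tail_rv unfolding regularly_varying_def by blast

lemma quantile_eq: "0 < s \<Longrightarrow> quantile F s = Inf {x. s \<le> cdf \<nu> x}"
proof -
  assume s: "0 < s"
  have "{x. 0 < x \<and> s \<le> F x} = {x. s \<le> cdf \<nu> x}"
  proof (intro Collect_cong iffI conjI)
    fix x assume "s \<le> cdf \<nu> x"
    then have "\<not> x \<le> 1" using F_eq_0[of x] s by (auto simp: F_def)
    then show "0 < x" by simp
  qed (auto simp: F_def)
  then show ?thesis using s by (simp add: quantile_def)
qed

lemma quantile_le_iff: "0 < s \<Longrightarrow> s < 1 \<Longrightarrow> quantile F s \<le> x \<longleftrightarrow> s \<le> F x"
  using pseudoinverse[of s x] quantile_eq[of s] F_def by metis

lemma F_quantile: "0 < s \<Longrightarrow> s < 1 \<Longrightarrow> F (quantile F s) = s"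
proof (rule antisym)
  assume s: "0 < s" "s < 1"
  have "(F \<longlongrightarrow> F (quantile F s)) (at_left (quantile F s))"
    using isCont_F by (auto simp: isCont_def intro: tendsto_within_subset)
  moreover have "\<forall>\<^sub>F x in at_left (quantile F s). F x \<le> s"
    using eventually_at_left_real[of "quantile F s - 1" "quantile F s", simplified]
    by eventually_elim (use quantile_le_iff[OF s] in \<open>meson not_le less_imp_le\<close>)
  ultimately show "F (quantile F s) \<le> s"
    by (rule tendsto_upperbound) simp
  show "s \<le> F (quantile F s)" using quantile_le_iff[OF s, of "quantile F s"] by simp
qed

lemma quantile_tendsto_right:
  assumes "0 \<le> s" "s < 1"
  shows "(quantile F \<longlongrightarrow> quantile F s) (at_right s)" and "\<forall>\<^sub>F u in at_right s. s < u \<and> u < 1"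
proof -
  have "(quantile F \<longlongrightarrow> quantile F s) (at s within {0..<1})"
    by (rule quantile_cont[unfolded continuous_on_def, rule_format]) (use assms in simp)
  then have "(quantile F \<longlongrightarrow> quantile F s) (at s within {s<..<1})"
    by (rule tendsto_within_subset) (use assms in auto)
  also have "at s within {s<..<1} = at_right s"
    by (rule at_within_nhd[where S = "{..<1}"]) (use assms in auto)
  finally show "(quantile F \<longlongrightarrow> quantile F s) (at_right s)" .
  show "\<forall>\<^sub>F u in at_right s. s < u \<and> u < 1"
    using eventually_at_right_real[OF assms(2)] by eventually_elim simp
qed

lemma left_endpoint_ge_1: "1 \<le> left_endpoint" and F_left_endpoint: "F left_endpoint = 0"
proof -
  note lim = quantile_tendsto_right[OF order_refl zero_less_one]
  show "1 \<le> left_endpoint"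
  proof (rule tendsto_lowerbound[OF lim(1)])
    show "\<forall>\<^sub>F u in at_right 0. 1 \<le> quantile F u"
      using lim(2)
    proof eventually_elim
      case (elim u)
      then show ?case using F_quantile[of u] F_eq_0[of "quantile F u"] by linarith
    qed
  qed simp
  have "((\<lambda>u. F (quantile F u)) \<longlongrightarrow> F left_endpoint) (at_right 0)"
    by (rule isCont_tendsto_compose[OF isCont_F lim(1)])
  moreover have "((\<lambda>u. F (quantile F u)) \<longlongrightarrow> 0) (at_right 0)"
  proof (rule Lim_transform_eventually[OF tendsto_ident_at])
    show "\<forall>\<^sub>F u in at_right 0. u = F (quantile F u)"
      using lim(2) by eventually_elim (simp add: F_quantile)
  qed
  ultimately show "F left_endpoint = 0" by (rule tendsto_unique[OF trivial_limit_at_right_real])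
qed

text \<open>
  A flat piece of \<open>F\<close> above the left endpoint would be a jump of the quantile function: at the level \<open>s\<close> of the
  piece the quantile is at most \<open>x\<close>, but immediately above \<open>s\<close> it is at least \<open>t\<close>. At level \<open>s = 0\<close> the
  quantile is the left endpoint, which is why that value is singled out.
\<close>
lemma F_strict_mono:
  assumes x: "left_endpoint \<le> x" "x < t"
  shows "F x < F t"
proof (rule ccontr)
  assume "\<not> F x < F t"
  then have eq: "F x = F t" using F_mono[of x t] x by linarith
  have s: "0 \<le> F x" "F x < 1" using F_nonneg tail_pos[of x] by (auto simp: tail_def)
  have "quantile F (F x) \<le> x"
    using s x quantile_le_iff[of "F x" x] by (cases "F x = 0") auto
  moreover have "t \<le> quantile F (F x)"
  proof (rule tendsto_lowerbound[OF quantile_tendsto_right(1)[OF s]])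
    show "\<forall>\<^sub>F u in at_right (F x). t \<le> quantile F u"
      using quantile_tendsto_right(2)[OF s]
    proof eventually_elim
      case (elim u)
      then show ?case using quantile_le_iff[of u t] s eq by linarith
    qed
  qed simp
  ultimately show False using x by simp
qed

lemma AE_ge_left_endpoint: "AE v in \<nu>. left_endpoint \<le> v"
proof -
  have "prob {..left_endpoint} = 0" using F_left_endpoint by (simp only: F_eq_prob)
  then have "{..left_endpoint} \<in> null_sets \<nu>" by (intro null_setsI) (simp_all only: emeasure_eq_measure ennreal_0 events_eq_borel borel_closed closed_atMost)
  then show ?thesis by (rule AE_I') auto
qed

text \<open>
  After the substitution \<open>s = 1 - u\<close> the region of integration is \<open>u \<ge> F x\<close>. Up to null sets this is the event that the
  quantile at \<open>u\<close> exceeds \<open>x\<close>, and the quantile of a uniform variable has law \<open>\<nu>\<close>.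
\<close>
lemma integral_quantile:
  fixes f :: "real \<Rightarrow> real"
  assumes f: "f \<in> borel_measurable borel"
  shows "(LBINT s:{0..tail F x}. f (quantile F (1 - s))) = (\<integral>v. indicator {x<..} v * f v \<partial>\<nu>)"
proof -
  let ?h = "\<lambda>v. indicator {x<..} v * f v" and ?Q = "\<lambda>u. Inf {x. u \<le> cdf \<nu> x}"
  define g where "g s = indicator {0..tail F x} s *\<^sub>R f (quantile F (1 - s))" for s
  have "(LBINT s:{0..tail F x}. f (quantile F (1 - s))) = (\<integral>s. g s \<partial>lborel)"
    unfolding set_lebesgue_integral_def g_def ..
  also have "\<dots> = \<bar>- 1\<bar> *\<^sub>R (\<integral>u. g (1 + (- 1) * u) \<partial>lborel)"
    by (rule lborel_integral_real_affine) simp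
  also have "\<dots> = (\<integral>u. indicator {0..tail F x} (1 - u) * f (quantile F u) \<partial>lborel)"
    by (simp add: g_def)
  also have "\<dots> = (\<integral>u. indicator {0<..<1} u *\<^sub>R ?h (?Q u) \<partial>lborel)"
  \<comment> \<open>At the level \<open>u = F x\<close> the quantile may equal \<open>x\<close>; the levels 0 and 1 lie outside the range of the quantile transform.\<close>
  proof (rule integral_discrete_difference[where X = "{0, 1, F x}"])
    fix u assume u: "u \<notin> {0, 1, F x}"
    show "indicator {0..tail F x} (1 - u) * f (quantile F u) = indicator {0<..<1} u *\<^sub>R ?h (?Q u)"
    proof (cases "0 < u \<and> u < 1")
      case True
      then have "1 - u \<in> {0..tail F x} \<longleftrightarrow> x < quantile F u"
        using quantile_le_iff[of u x] u by (auto simp: tail_def)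
      then show ?thesis using True by (simp add: quantile_eq indicator_def)
    next
      case False
      then show ?thesis using u F_nonneg[of x] by (auto simp: indicator_def tail_def)
    qed
  qed auto
  also have "\<dots> = (\<integral>u. ?h (?Q u) \<partial>restrict_space lborel {0<..<1})"
    by (subst integral_restrict_space) auto
  also have "\<dots> = (\<integral>v. ?h v \<partial>distr (restrict_space lborel {0<..<1}) borel ?Q)"
  proof (rule integral_distr[symmetric])
    have "sets (restrict_space lborel {0<..<1::real}) = sets (restrict_space borel {0<..<1})"
      by (intro sets_restrict_space_cong) simp
    then show "?Q \<in> measurable (restrict_space lborel {0<..<1}) borel"
      using measurable_CI by (simp cong: measurable_cong_sets)
    show "?h \<in> borel_measurable borel" using f by measurable
  qed
  finally show ?thesis by (simp only: distr_I_eq_M)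
qed

text \<open>
  The second moment is bounded by the series \<open>\<Sum>\<^sub>j (2j + 1) G(t e\<^sup>j)\<close>. Regular variation makes the ratio of consecutive terms tend to
  \<open>exp (-\<alpha>) < 1\<close>.
\<close>
lemma integrable_log_excess_square:
  assumes t: "0 < t"
  shows "integrable \<nu> (\<lambda>v. (log_excess t v)\<^sup>2)"
proof (rule integrableI_bounded)
  define a where "a j = (2 * real j + 1) * tail F (t * exp (real j))" for j
  have a_pos: "0 < a j" for j using tail_pos by (simp add: a_def)
  have "summable a"
  proof -
    have "filterlim (\<lambda>j. t * exp (real j)) at_top sequentially" using t by real_asymp
    from filterlim_compose[OF tail_ratio_tendsto[of "exp 1"] this]
    have "(\<lambda>j. tail F (t * exp (real j) * exp 1) / tail F (t * exp (real j))) \<longlonglongrightarrow> exp (- \<alpha>)"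
      by (simp add: powr_def)
    moreover have "(\<lambda>j. (2 * real (Suc j) + 1) / (2 * real j + 1)) \<longlonglongrightarrow> 1" by real_asymp
    ultimately have "(\<lambda>j. (2 * real (Suc j) + 1) / (2 * real j + 1) *
        (tail F (t * exp (real j) * exp 1) / tail F (t * exp (real j)))) \<longlonglongrightarrow> 1 * exp (- \<alpha>)"
      by (intro tendsto_mult)
    moreover have "(2 * real (Suc j) + 1) / (2 * real j + 1) *
        (tail F (t * exp (real j) * exp 1) / tail F (t * exp (real j))) = a (Suc j) / a j" for j
      by (simp add: a_def exp_add mult_ac add.commute)
    ultimately have lim: "(\<lambda>j. a (Suc j) / a j) \<longlonglongrightarrow> exp (- \<alpha>)" by simp
    have "exp (- \<alpha>) < 1" using \<alpha>_pos by simp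
    then obtain c where c: "exp (- \<alpha>) < c" "c < 1" using dense by blast
    then obtain N where N: "\<And>j. N \<le> j \<Longrightarrow> a (Suc j) / a j < c"
      using order_tendstoD(2)[OF lim] by (auto simp: eventually_sequentially)
    show ?thesis
    proof (rule summable_ratio_test[OF c(2)])
      fix j assume "N \<le> j"
      then show "norm (a (Suc j)) \<le> c * norm (a j)"
        using N[of j] a_pos[of j] a_pos[of "Suc j"] by (simp add: field_simps)
    qed
  qed
  have "(\<integral>\<^sup>+v. ennreal (norm ((log_excess t v)\<^sup>2)) \<partial>\<nu>)
      \<le> (\<integral>\<^sup>+v. (\<Sum>j. ennreal (2 * real j + 1) * indicator {t * exp (real j)<..} v) \<partial>\<nu>)"
    using log_excess_square_le_suminf[OF t] by (intro nn_integral_mono) simp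
  also have "\<dots> = (\<Sum>j. \<integral>\<^sup>+v. ennreal (2 * real j + 1) * indicator {t * exp (real j)<..} v \<partial>\<nu>)"
    by (intro nn_integral_suminf) simp
  also have "\<dots> = (\<Sum>j. ennreal (a j))"
  proof (rule suminf_cong)
    fix j
    show "(\<integral>\<^sup>+v. ennreal (2 * real j + 1) * indicator {t * exp (real j)<..} v \<partial>\<nu>) = ennreal (a j)"
      by (subst nn_integral_cmult_indicator)
        (auto simp: emeasure_eq_measure prob_greaterThan a_def ennreal_mult' intro: less_imp_le[OF tail_pos])
  qed
  also have "\<dots> = ennreal (\<Sum>j. a j)" using \<open>summable a\<close> a_pos by (intro suminf_ennreal2) (auto intro: less_imp_le)
  also have "\<dots> < \<infinity>" by simp
  finally show "(\<integral>\<^sup>+v. ennreal (norm ((log_excess t v)\<^sup>2)) \<partial>\<nu>) < \<infinity>" .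
qed simp

lemma integrable_log_excess: "0 < t \<Longrightarrow> integrable \<nu> (log_excess t)"
  by (rule square_integrable_imp_integrable[OF _ integrable_log_excess_square]) auto

text \<open>
  The mean log-excess is the integral of \<open>G(u)/u\<close> over \<open>[t, \<infinity>)\<close>, which this expresses through increments. It carries
  positivity, continuity and the Karamata asymptotics.
\<close>
lemma mean_log_excess_step:
  assumes "0 < x" "1 \<le> c"
  shows "ln c * tail F (x * c) \<le> mean_log_excess x - mean_log_excess (x * c) \<and>
    mean_log_excess x - mean_log_excess (x * c) \<le> ln c * tail F x"
proof -
  have int: "integrable \<nu> (log_excess x)" "integrable \<nu> (log_excess (x * c))"
    using assms by (auto intro!: integrable_log_excess)
  have int_ind: "integrable \<nu> (\<lambda>v. ln c * indicator {y<..} v)" for y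
    by (intro integrable_mult_right integrable_indicator_greaterThan)
  have diff: "mean_log_excess x - mean_log_excess (x * c) = (\<integral>v. log_excess x v - log_excess (x * c) v \<partial>\<nu>)"
    using int by (simp add: mean_log_excess_def)
  have ind: "(\<integral>v. ln c * indicator {y<..} v \<partial>\<nu>) = ln c * tail F y" for y
    by (simp add: prob_greaterThan)
  have "(\<integral>v. ln c * indicator {x * c<..} v \<partial>\<nu>) \<le> mean_log_excess x - mean_log_excess (x * c)"
    unfolding diff using int assms by (intro integral_mono log_excess_step int_ind) auto
  moreover have "mean_log_excess x - mean_log_excess (x * c) \<le> (\<integral>v. ln c * indicator {x<..} v \<partial>\<nu>)"
    unfolding diff using int assms by (intro integral_mono log_excess_step int_ind) auto
  ultimately show ?thesis by (simp only: ind)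
qed

lemma mean_log_excess_pos: "0 < x \<Longrightarrow> 0 < mean_log_excess x"
proof -
  assume x: "0 < x"
  have "0 \<le> mean_log_excess (x * exp 1)"
    unfolding mean_log_excess_def using x by (intro integral_nonneg_AE AE_I2 log_excess_nonneg) auto
  then show ?thesis using mean_log_excess_step[OF x, of "exp 1"] tail_pos[of "x * exp 1"] by simp
qed

lemma isCont_mean_log_excess:
  assumes x: "0 < x"
  shows "isCont mean_log_excess x"
proof -
  have ordered: "\<bar>mean_log_excess b - mean_log_excess a\<bar> \<le> ln b - ln a" if "0 < a" "a \<le> b" for a b
  proof -
    have "0 \<le> ln (b/a)" using that by simp
    then have "0 \<le> ln (b/a) * tail F b" "ln (b/a) * tail F a \<le> ln (b/a) * 1"
      using tail_pos[of b] tail_le_1[of a] by (intro mult_left_mono mult_nonneg_nonneg; simp)+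
    then show ?thesis using mean_log_excess_step[of a "b/a"] that by (simp add: ln_div)
  qed
  have lipschitz: "\<bar>mean_log_excess y - mean_log_excess x\<bar> \<le> \<bar>ln y - ln x\<bar>" if "0 < y" for y
    using ordered[of x y] ordered[of y x] that x by (cases "x \<le> y") auto
  have "\<forall>\<^sub>F y in at x. 0 < y"
    using order_tendstoD(1)[OF tendsto_ident_at x] .
  then have "\<forall>\<^sub>F y in at x. norm (mean_log_excess y - mean_log_excess x) \<le> \<bar>ln y - ln x\<bar>"
    by eventually_elim (simp add: lipschitz)
  moreover have "((\<lambda>y. \<bar>ln y - ln x\<bar>) \<longlongrightarrow> \<bar>ln x - ln x\<bar>) (at x)"
    using x by (intro tendsto_intros) auto
  then have "((\<lambda>y. \<bar>ln y - ln x\<bar>) \<longlongrightarrow> 0) (at x)" by simp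
  ultimately have "((\<lambda>y. mean_log_excess y - mean_log_excess x) \<longlongrightarrow> 0) (at x)"
    by (rule Lim_null_comparison)
  then show ?thesis unfolding isCont_def by (rule Lim_null[THEN iffD2])
qed

lemma mean_log_excess_tendsto_0: "(mean_log_excess \<longlongrightarrow> 0) at_top"
proof -
  have "((\<lambda>t. \<integral>v. log_excess t v \<partial>\<nu>) \<longlongrightarrow> (\<integral>v. 0 \<partial>\<nu>)) at_top"
  proof (rule integral_dominated_convergence_at_top)
    show "integrable \<nu> (log_excess 1)" by (rule integrable_log_excess) simp
    show "AE v in \<nu>. ((\<lambda>t. log_excess t v) \<longlongrightarrow> 0) at_top"
    proof (rule AE_I2, rule tendsto_eventually)
      fix v :: real
      show "\<forall>\<^sub>F t in at_top. log_excess t v = 0"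
        using eventually_ge_at_top[of v] by eventually_elim (simp add: log_excess_def)
    qed
    show "\<forall>\<^sub>F t in at_top. AE v in \<nu>. norm (log_excess t v) \<le> log_excess 1 v"
      using eventually_ge_at_top[of "1::real"]
    proof eventually_elim
      case (elim t)
      then show ?case
        using monotone_onD[OF log_excess_antimono, of 1 t] log_excess_nonneg[of t] by auto
    qed
  qed auto
  then show ?thesis by (simp add: mean_log_excess_def[abs_def])
qed

lemma mean_excess_ratio_tendsto: "((\<lambda>x. mean_log_excess x / tail F x) \<longlongrightarrow> 1 / \<alpha>) at_top"
  using \<alpha>_pos tail_rv tail_pos mean_log_excess_tendsto_0 mean_log_excess_step
  by (rule karamata_ratio_tendsto)

text \<open>
  Both integrals are expectations over \<open>X > x\<close>: the denominator is \<open>\<phi>(x)\<close>, and splitting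
  \<open>ln v = log_excess x v + ln x\<close> in the numerator cancels the term \<open>\<alpha> ln x G(x)\<close>.
\<close>
lemma limit_exponent_eq:
  assumes x: "0 < x"
  shows "limit_exponent \<alpha> F x = \<alpha> - tail F x / mean_log_excess x"
proof -
  have J: "(LBINT s:{0..tail F x}. ln (quantile F (1 - s) / x)) = mean_log_excess x"
  proof -
    have "(LBINT s:{0..tail F x}. ln (quantile F (1 - s) / x)) = (\<integral>v. indicator {x<..} v * ln (v / x) \<partial>\<nu>)"
      by (rule integral_quantile) simp
    also have "(\<lambda>v. indicator {x<..} v * ln (v / x)) = log_excess x"
      by (auto simp: log_excess_def indicator_def)
    finally show ?thesis by (simp add: mean_log_excess_def)
  qed
  have "(LBINT s:{0..tail F x}. ln (quantile F (1 - s))) = (\<integral>v. indicator {x<..} v * ln v \<partial>\<nu>)"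
    by (rule integral_quantile) simp
  also have "(\<lambda>v. indicator {x<..} v * ln v) = (\<lambda>v. log_excess x v + ln x * indicator {x<..} v)"
    using x by (auto simp: log_excess_def indicator_def ln_div)
  also have "(\<integral>v. log_excess x v + ln x * indicator {x<..} v \<partial>\<nu>) = mean_log_excess x + ln x * tail F x"
    using integrable_log_excess[OF x] integrable_indicator_greaterThan[of x]
    by (subst Bochner_Integration.integral_add) (simp_all add: mean_log_excess_def prob_greaterThan)
  finally have "(LBINT s:{0..tail F x}. ln (quantile F (1 - s))) = mean_log_excess x + ln x * tail F x" .
  then show ?thesis
    unfolding limit_exponent_def J using mean_log_excess_pos[OF x] by (simp add: field_simps)
qed

text \<open>
  Multiplying out \<open>y powr -\<alpha>\<close> removes the slowly varying part: the remaining distance is between the conditional tail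
  beyond \<open>x\<close> and a Pareto tail with matching mean logarithm.
\<close>
lemma limit_distance_eq:
  assumes x: "0 < x"
  shows "limit_distance \<alpha> F x =
    (SUP y\<in>{1..}. \<bar>tail F (x * y) / tail F x - y powr (- inverse (mean_log_excess x / tail F x))\<bar>)"
  unfolding limit_distance_def
proof (rule SUP_cong)
  fix y :: real assume "y \<in> {1..}"
  then have y: "1 \<le> y" by simp
  have "slow_part \<alpha> F (x * y) / slow_part \<alpha> F x = y powr \<alpha> * (tail F (x * y) / tail F x)"
    using x y by (simp add: slow_part_def powr_mult)
  moreover have scale: "c * \<bar>A - B * D\<bar> = \<bar>c * A - c * B * D\<bar>" if "0 \<le> c" for A B c D :: real
    using abs_mult[of c "A - B * D"] that by (simp add: right_diff_distrib mult.assoc)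
  ultimately have "y powr (- \<alpha>) * \<bar>y powr limit_exponent \<alpha> F x - slow_part \<alpha> F (x * y) / slow_part \<alpha> F x\<bar> =
      \<bar>y powr (- \<alpha>) * y powr limit_exponent \<alpha> F x - y powr (- \<alpha>) * y powr \<alpha> * (tail F (x * y) / tail F x)\<bar>"
    by (simp only: scale[OF powr_ge_zero])
  also have "y powr (- \<alpha>) * y powr limit_exponent \<alpha> F x = y powr (- inverse (mean_log_excess x / tail F x))"
    using limit_exponent_eq[OF x] by (simp add: powr_add[symmetric])
  also have "y powr (- \<alpha>) * y powr \<alpha> = 1" using y by (simp add: powr_add[symmetric])
  finally show "y powr (- \<alpha>) * \<bar>y powr limit_exponent \<alpha> F x - slow_part \<alpha> F (x * y) / slow_part \<alpha> F x\<bar> =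
      \<bar>tail F (x * y) / tail F x - y powr (- inverse (mean_log_excess x / tail F x))\<bar>"
    by (simp add: abs_minus_commute)
qed simp

lemma limit_distance_summand_le_1:
  assumes x: "0 < x" and y: "1 \<le> y"
  shows "\<bar>tail F (x * y) / tail F x - y powr (- inverse (mean_log_excess x / tail F x))\<bar> \<le> 1"
proof -
  have "tail F (x * y) \<le> tail F x" using x y by (intro monotone_onD[OF tail_antimono[of UNIV]]) auto
  then have "tail F (x * y) / tail F x \<le> 1" "0 \<le> tail F (x * y) / tail F x"
    using tail_pos[of x] tail_pos[of "x * y"] by auto
  moreover have "y powr (- inverse (mean_log_excess x / tail F x)) \<le> 1"
    using monotone_onD[OF powr_minus_antimono_on[of "inverse (mean_log_excess x / tail F x)"], of 1 y]
      y mean_log_excess_pos[OF x] tail_pos[of x] by simp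
  ultimately show ?thesis
    using powr_ge_zero[of y "- inverse (mean_log_excess x / tail F x)"] by linarith
qed

text \<open>
  A vanishing distance makes the tail an exact power beyond \<open>x\<close>. Regular variation then identifies its exponent.
\<close>
theorem limit_distance_pos:
  assumes not_pareto: "\<not> eventually_pareto \<alpha> F" and x: "1 \<le> x"
  shows "0 < limit_distance \<alpha> F x"
proof (rule ccontr)
  assume neg: "\<not> 0 < limit_distance \<alpha> F x"
  define \<theta> where "\<theta> = inverse (mean_log_excess x / tail F x)"
  have x0: "0 < x" using x by simp
  have power: "tail F (x * y) = tail F x * y powr (- \<theta>)" if y: "1 \<le> y" for y
  proof -
    have "\<bar>tail F (x * y) / tail F x - y powr (- \<theta>)\<bar> \<le> limit_distance \<alpha> F x"
      unfolding limit_distance_eq[OF x0] \<theta>_def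
      using y limit_distance_summand_le_1[OF x0]
      by (intro cSUP_upper bdd_aboveI2[of _ _ 1]) auto
    then have "tail F (x * y) / tail F x = y powr (- \<theta>)" using neg by linarith
    then show ?thesis using tail_pos[of x] by (simp add: field_simps)
  qed
  have "((\<lambda>t. tail F (t * exp 1) / tail F t) \<longlongrightarrow> exp 1 powr (- \<alpha>)) at_top"
    by (rule tail_ratio_tendsto) simp
  moreover have "\<forall>\<^sub>F t in at_top. tail F (t * exp 1) / tail F t = exp 1 powr (- \<theta>)"
    using eventually_ge_at_top[of x]
  proof eventually_elim
    case (elim t)
    define s where "s = t / x"
    have s: "1 \<le> s" "t = x * s" using elim x0 by (auto simp: s_def)
    then have "1 \<le> s * exp 1" using mult_mono[of 1 s 1 "exp (1::real)"] by simp
    then have "tail F (t * exp 1) = tail F x * (s powr (- \<theta>) * exp 1 powr (- \<theta>))"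
      using power[of "s * exp 1"] s by (simp only: powr_mult mult.assoc)
    moreover have "tail F t = tail F x * s powr (- \<theta>)" using power[of s] s by simp
    ultimately show ?case using tail_pos[of x] s(1) by simp
  qed
  then have "((\<lambda>t. tail F (t * exp 1) / tail F t) \<longlongrightarrow> exp 1 powr (- \<theta>)) at_top"
    by (rule tendsto_eventually)
  ultimately have "exp 1 powr (- \<alpha>) = exp (1::real) powr (- \<theta>)"
    by (rule tendsto_unique[OF trivial_limit_at_top_linorder])
  then have \<theta>: "\<theta> = \<alpha>" by (simp add: powr_def)
  have "tail F z = (tail F x * x powr \<alpha>) * z powr (- \<alpha>)" if "x \<le> z" for z
  proof -
    have "tail F z = tail F x * (z / x) powr (- \<alpha>)" using power[of "z / x"] that x0 \<theta> by simp
    also have "(z / x) powr (- \<alpha>) = z powr (- \<alpha>) / x powr (- \<alpha>)" using x0 that by (simp add: powr_divide)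
    finally show ?thesis by (simp add: powr_minus field_simps)
  qed
  moreover have "0 < tail F x * x powr \<alpha>" using tail_pos x0 by simp
  ultimately have "eventually_pareto \<alpha> F" unfolding eventually_pareto_def by blast
  with not_pareto show False ..
qed

text \<open>
  Rescaled by \<open>x\<close>, the tail tends to the Pareto tail, and its index tends to \<open>\<alpha>\<close> by Karamata's theorem. So the continuity of the
  distance functional applies with threshold 1 and the Pareto tail as the limit.
\<close>
lemma limit_distance_tendsto_0: "(limit_distance \<alpha> F \<longlongrightarrow> 0) at_top"
proof -
  let ?g = "\<lambda>x t. tail F (x * t) / tail F x"
  have "((\<lambda>x. SUP y\<in>{1..}. \<bar>?g x (1 * y) / 1 - y powr (- inverse (mean_log_excess x / tail F x))\<bar>)
      \<longlongrightarrow> (SUP y\<in>{1..}. \<bar>(1 * y) powr (- \<alpha>) / 1 powr (- \<alpha>) - y powr (- inverse (1 / \<alpha>))\<bar>)) at_top"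
  proof (rule KS_functional_tendsto[where G = "\<lambda>t. t powr - \<alpha>" and x = 1 and T = "\<lambda>_. 1" and p = "\<lambda>_. 1"
        and g = ?g and h = "\<lambda>x. mean_log_excess x / tail F x"])
    show "\<forall>\<^sub>F x in at_top. antimono_on {0<..} (?g x) \<and> (\<forall>t>0. 0 \<le> ?g x t)"
      using eventually_gt_at_top[of 0]
    proof eventually_elim
      case (elim x)
      then show ?case
        using less_imp_le[OF tail_pos] monotone_onD[OF tail_antimono[of UNIV]]
        by (auto intro!: monotone_onI divide_right_mono divide_nonneg_nonneg)
    qed
    show "((\<lambda>x. mean_log_excess x / tail F x) \<longlongrightarrow> 1 / \<alpha>) at_top" by (rule mean_excess_ratio_tendsto)
    show "antimono_on {0<..} (\<lambda>t. t powr - \<alpha>)"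
      using \<alpha>_pos by (auto intro!: monotone_onI powr_mono2')
    show "((\<lambda>t. t powr - \<alpha>) \<longlongrightarrow> 0) at_top"
      using \<alpha>_pos by (intro tendsto_neg_powr filterlim_ident) auto
    show "((\<lambda>x. ?g x t) \<longlongrightarrow> t powr - \<alpha>) at_top" if "0 < t" for t
      using that by (rule tail_ratio_tendsto)
    show "continuous_on {0<..} (\<lambda>t. t powr - \<alpha>)" by (intro continuous_intros) auto
  qed (use \<alpha>_pos in \<open>auto intro: tendsto_const\<close>)
  then have "((\<lambda>x. SUP y\<in>{1..}. \<bar>tail F (x * y) / tail F x - y powr (- inverse (mean_log_excess x / tail F x))\<bar>)
      \<longlongrightarrow> 0) at_top" by simp
  moreover have "\<forall>\<^sub>F x in at_top. (SUP y\<in>{1..}. \<bar>tail F (x * y) / tail F x - y powr (- inverse (mean_log_excess x / tail F x))\<bar>)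
      = limit_distance \<alpha> F x"
    using eventually_gt_at_top[of 0] by eventually_elim (simp add: limit_distance_eq)
  ultimately show ?thesis by (rule Lim_transform_eventually)
qed

lemma tail_index_bounds:
  shows "n = 0 \<and> tail_index F x n = 0 \<or> tail_index F x n < n"
    and "tail F x * real n - 1 \<le> real (tail_index F x n)"
    and "real (tail_index F x n) \<le> tail F x * real n"
proof -
  let ?k = "nat \<lfloor>tail F x * real n\<rfloor>"
  have nn: "0 \<le> tail F x * real n" using tail_pos[of x] by simp
  have "tail F x * real n \<le> 1 * real n" using tail_le_1 by (intro mult_right_mono) auto
  then have le: "?k \<le> n" by linarith
  have k: "real ?k \<le> tail F x * real n" "tail F x * real n - 1 \<le> real ?k" using nn by linarith+
  show "n = 0 \<and> tail_index F x n = 0 \<or> tail_index F x n < n"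
    using le by (auto simp: tail_index_def Let_def)
  show "tail F x * real n - 1 \<le> real (tail_index F x n)"
    using k \<open>tail F x * real n \<le> 1 * real n\<close> by (auto simp: tail_index_def Let_def)
  show "real (tail_index F x n) \<le> tail F x * real n"
    using k by (auto simp: tail_index_def Let_def)
qed

lemma tail_index_ratio_tendsto: "(\<lambda>n. real (tail_index F x n) / real n) \<longlonglongrightarrow> tail F x"
proof (rule tendsto_sandwich)
  show "\<forall>\<^sub>F n in sequentially. tail F x - 1 / real n \<le> real (tail_index F x n) / real n"
    using eventually_gt_at_top[of 0]
  proof eventually_elim
    case (elim n)
    then have "tail F x - 1 / real n = (tail F x * real n - 1) / real n" by (simp add: field_simps)
    then show ?case using tail_index_bounds(2)[of x n] by (simp add: divide_right_mono)
  qed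
  show "\<forall>\<^sub>F n in sequentially. real (tail_index F x n) / real n \<le> tail F x"
    using eventually_gt_at_top[of 0]
    by eventually_elim (use tail_index_bounds(3)[where x = x] in \<open>simp add: field_simps\<close>)
  show "(\<lambda>n. tail F x - 1 / real n) \<longlonglongrightarrow> tail F x"
    using tendsto_diff[OF tendsto_const lim_1_over_n, of "tail F x"] by simp
qed simp

lemma tail_index_eventually_valid: "\<forall>\<^sub>F n in sequentially. 1 \<le> tail_index F x n \<and> tail_index F x n < n"
proof -
  have "filterlim (\<lambda>n. tail F x * real n) at_top sequentially"
    by (rule filterlim_tendsto_pos_mult_at_top[OF tendsto_const tail_pos filterlim_real_sequentially])
  then have "\<forall>\<^sub>F n in sequentially. 2 \<le> tail F x * real n" by (simp add: filterlim_at_top)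
  then show ?thesis using eventually_gt_at_top[of 0]
  proof eventually_elim
    case (elim n)
    then show ?case using tail_index_bounds(1)[of n x] tail_index_bounds(2)[of x n] by auto
  qed
qed

end

section \<open>Samples from the law\<close>

locale heavy_tailed_sample = heavy_tailed_law \<nu> F \<alpha> + M: prob_space M
  for \<nu> F \<alpha> and M :: "'a measure" +
  fixes X :: "nat \<Rightarrow> 'a \<Rightarrow> real"
  assumes indep: "M.indep_vars (\<lambda>_. borel) X {1..}"
    and distributed: "\<And>i. 1 \<le> i \<Longrightarrow> distr M borel (X i) = \<nu>"
begin

lemma X_measurable: "1 \<le> i \<Longrightarrow> X i \<in> borel_measurable M"
  using indep unfolding M.indep_vars_def by auto

lemma empirical_tail_tendsto:
  "((\<lambda>(n, \<omega>). sample_mean X n (indicator {t<..}) \<omega>) \<longlongrightarrow> tail F t) (whp M)"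
proof -
  have "(\<lambda>v. (indicator {t<..} v :: real)\<^sup>2) = indicator {t<..}" by (auto simp: indicator_def)
  then show ?thesis
    using M.weak_law_of_large_numbers[OF indep distributed, of "indicator {t<..}"] integrable_indicator_greaterThan[of t]
    by (simp add: prob_greaterThan)
qed

lemma empirical_log_excess_tendsto:
  "0 < t \<Longrightarrow> ((\<lambda>(n, \<omega>). sample_mean X n (log_excess t) \<omega>) \<longlongrightarrow> mean_log_excess t) (whp M)"
  unfolding mean_log_excess_def
  by (intro M.weak_law_of_large_numbers[OF indep distributed] integrable_log_excess_square) auto

text \<open>
  When \<open>x\<close> is the left endpoint, no comparison of tail values keeps the threshold from falling below \<open>x\<close>, since \<open>G\<close> equals 1
  at and below that point; this does.
\<close>
lemma whp_sample_ge_left_endpoint: "\<forall>\<^sub>F (n, \<omega>) in whp M. \<forall>i\<ge>1. left_endpoint \<le> X i \<omega>"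
proof (rule eventually_whp_of_AE)
  have "AE \<omega> in M. left_endpoint \<le> X i \<omega>" if "1 \<le> i" for i
    using AE_ge_left_endpoint unfolding distributed[OF that, symmetric]
    by (subst (asm) AE_distr_iff[OF X_measurable[OF that]]) auto
  then show "AE \<omega> in M. \<forall>i\<ge>1. left_endpoint \<le> X i \<omega>" by (auto simp: AE_all_countable)
qed

text \<open>
  Stated for an arbitrary filter \<open>\<H>\<close> mapped into \<open>whp M\<close>, since the index \<open>k\<close> is a function of \<open>n\<close> when the
  distance is studied at one point, but ranges freely when the minimizer is.
\<close>
lemma KS_distance_tendsto:
  assumes lim: "filterlim (\<lambda>i. (N i, W i)) (whp M) \<H>"
    and K: "\<forall>\<^sub>F i in \<H>. 1 \<le> K i \<and> K i < N i"
    and x: "0 < x" and T: "((\<lambda>i. order_stat X (N i) (N i - K i) (W i)) \<longlongrightarrow> x) \<H>"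
  shows "((\<lambda>i. KS_distance X (N i) (K i) (W i)) \<longlongrightarrow> limit_distance \<alpha> F x) \<H>"
proof -
  define T' where "T' i = order_stat X (N i) (N i - K i) (W i)" for i
  define g where "g i t = sample_mean X (N i) (indicator {t<..}) (W i)" for i t
  define q where "q i t = sample_mean X (N i) (log_excess t) (W i)" for i t
  define p where "p i = real (K i) / real (N i)" for i
  note T' = T[folded T'_def]
  have g_lim: "((\<lambda>i. g i t) \<longlongrightarrow> tail F t) \<H>" for t
    using filterlim_compose[OF empirical_tail_tendsto lim] by (simp add: g_def)
  have q_lim: "((\<lambda>i. q i t) \<longlongrightarrow> mean_log_excess t) \<H>" if "0 < t" for t
    using filterlim_compose[OF empirical_log_excess_tendsto[OF that] lim] by (simp add: q_def)
  have T'_pos: "\<forall>\<^sub>F i in \<H>. 0 < T' i" using order_tendstoD(1)[OF T' x] .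
  have p_lim: "(p \<longlongrightarrow> tail F x) \<H>"
  proof (rule antitone_sandwich_tendsto[OF x T' g_lim isCont_tail])
    show "\<forall>\<^sub>F i in \<H>. (\<forall>s\<in>{0<..<T' i}. p i \<le> g i s) \<and> (\<forall>t>T' i. g i t \<le> p i)"
      using K by eventually_elim (auto simp: T'_def p_def g_def intro!: order_stat_threshold)
  qed
  have "((\<lambda>i. q i (T' i)) \<longlongrightarrow> mean_log_excess x) \<H>"
  proof (rule antitone_sandwich_tendsto[OF x T' q_lim isCont_mean_log_excess[OF x]])
    show "\<forall>\<^sub>F i in \<H>. (\<forall>s\<in>{0<..<T' i}. q i (T' i) \<le> q i s) \<and> (\<forall>t>T' i. q i t \<le> q i (T' i))"
      using T'_pos
    proof eventually_elim
      case (elim i)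
      then show ?case
        unfolding q_def by (auto intro!: sample_mean_mono monotone_onD[OF log_excess_antimono])
    qed
  qed
  then have h_lim: "((\<lambda>i. q i (T' i) / p i) \<longlongrightarrow> mean_log_excess x / tail F x) \<H>"
    using p_lim tail_pos[of x] by (intro tendsto_divide) auto
  have "((\<lambda>i. SUP y\<in>{1..}. \<bar>g i (T' i * y) / p i - y powr (- inverse (q i (T' i) / p i))\<bar>)
      \<longlongrightarrow> (SUP y\<in>{1..}. \<bar>tail F (x * y) / tail F x - y powr (- inverse (mean_log_excess x / tail F x))\<bar>)) \<H>"
  proof (rule KS_functional_tendsto[where G = "tail F" and T = T' and p = p and h = "\<lambda>i. q i (T' i) / p i"])
    show "0 < mean_log_excess x / tail F x" using mean_log_excess_pos[OF x] tail_pos by simp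
    show "\<forall>\<^sub>F i in \<H>. antimono_on {0<..} (g i) \<and> (\<forall>t>0. 0 \<le> g i t)"
      by (intro always_eventually allI conjI monotone_onI)
        (auto simp: g_def indicator_def intro!: sample_mean_mono sample_mean_nonneg)
  qed (rule x T' p_lim h_lim g_lim tail_antimono tail_cont tail_tendsto_0 tail_pos)+
  moreover have "\<forall>\<^sub>F i in \<H>. (SUP y\<in>{1..}. \<bar>g i (T' i * y) / p i - y powr (- inverse (q i (T' i) / p i))\<bar>)
      = KS_distance X (N i) (K i) (W i)"
    using K T'_pos
  proof eventually_elim
    case (elim i)
    then show ?case
      using KS_distance_eq_sample_means[of "K i" "N i" X "W i"] by (simp add: g_def q_def p_def T'_def)
  qed
  ultimately show ?thesis
    unfolding limit_distance_eq[OF x] by (rule Lim_transform_eventually)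
qed

text \<open>
  It remains to locate the threshold \<open>T\<close>. Since \<open>k/n\<close> tends to \<open>G(x)\<close> and the empirical tail is eventually close to \<open>G\<close> at any fixed
  point, strict monotonicity of \<open>G\<close> at \<open>x\<close> forces \<open>T\<close> into every neighbourhood of \<open>x\<close>.
\<close>
theorem KS_distance_tail_index_tendsto:
  assumes x: "left_endpoint \<le> x"
  shows "((\<lambda>(n, \<omega>). KS_distance X n (tail_index F x n) \<omega>) \<longlongrightarrow> limit_distance \<alpha> F x) (whp M)"
proof -
  define T where "T z = order_stat X (fst z) (fst z - tail_index F x (fst z)) (snd z)" for z :: "nat \<times> 'a"
  have valid: "\<forall>\<^sub>F z in whp M. 1 \<le> tail_index F x (fst z) \<and> tail_index F x (fst z) < fst z"
    using eventually_whp_of_sequentially[OF tail_index_eventually_valid[of x]] by (simp add: case_prod_unfold)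
  have p: "((\<lambda>z. real (tail_index F x (fst z)) / real (fst z)) \<longlongrightarrow> tail F x) (whp M)"
    using tendsto_whp_of_sequentially[OF tail_index_ratio_tendsto[of x]] by (simp add: case_prod_unfold)
  have g: "((\<lambda>z. sample_mean X (fst z) (indicator {t<..}) (snd z)) \<longlongrightarrow> tail F t) (whp M)" for t
    using empirical_tail_tendsto[of t] by (simp add: case_prod_unfold)
  have "(T \<longlongrightarrow> x) (whp M)"
  proof (rule order_tendstoI)
    fix t assume t: "x < t"
    obtain u where u: "x < u" "u < t" using dense[OF t] by blast
    have "tail F u < tail F x" using F_strict_mono[OF x u(1)] by (simp add: tail_def)
    then obtain c where c: "tail F u < c" "c < tail F x" using dense by blast
    show "\<forall>\<^sub>F z in whp M. T z < t"
      using order_tendstoD(2)[OF g c(1)] order_tendstoD(1)[OF p c(2)] valid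
    proof eventually_elim
      case (elim z)
      then have "\<not> u < T z"
        using order_stat_threshold(1)[of "tail_index F x (fst z)" "fst z" u X "snd z"] by (auto simp: T_def)
      then show ?case using u by simp
    qed
  next
    fix s assume s: "s < x"
    show "\<forall>\<^sub>F z in whp M. s < T z"
    proof (cases "left_endpoint \<le> s")
      case True
      have "tail F x < tail F s" using F_strict_mono[OF True s] by (simp add: tail_def)
      then obtain c where c: "tail F x < c" "c < tail F s" using dense by blast
      show ?thesis
        using order_tendstoD(1)[OF g c(2)] order_tendstoD(2)[OF p c(1)] valid
      proof eventually_elim
        case (elim z)
        then show ?case
          using order_stat_threshold(2)[of "tail_index F x (fst z)" "fst z" X "snd z" s] unfolding T_def by linarith
      qed
    next
      case False
      have "\<forall>\<^sub>F z in whp M. \<forall>i\<ge>1. left_endpoint \<le> X i (snd z)"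
        using whp_sample_ge_left_endpoint by (simp add: case_prod_unfold)
      then show ?thesis using valid
      proof eventually_elim
        case (elim z)
        have "left_endpoint \<le> T z"
          unfolding T_def using elim(1) elim(2)[THEN conjunct2] by (intro order_stat_ge) auto
        then show ?case using False by simp
      qed
    qed
  qed
  moreover have "filterlim (\<lambda>z. (fst z, snd z)) (whp M) (whp M)" by (simp add: filterlim_ident)
  moreover have "0 < x" using x left_endpoint_ge_1 by simp
  ultimately have "((\<lambda>z. KS_distance X (fst z) (tail_index F x (fst z)) (snd z)) \<longlongrightarrow> limit_distance \<alpha> F x) (whp M)"
    using KS_distance_tendsto[where N = fst and W = snd and K = "\<lambda>z. tail_index F x (fst z)"] valid
    unfolding T_def by blast
  then show ?thesis by (simp add: case_prod_unfold)
qed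

text \<open>
  The threshold exceeds \<open>B\<close> only if \<open>k/n\<close> is at most the empirical tail at \<open>B\<close>, which is eventually below \<open>\<epsilon>\<close> if
  \<open>G(B) < \<epsilon>\<close>. So all thresholds in question lie in \<open>[1, B]\<close>, and compactness makes the positive limits there uniform.
\<close>
lemma KS_distance_bounded_below:
  assumes not_pareto: "\<not> eventually_pareto \<alpha> F" and \<epsilon>: "0 < \<epsilon>"
  shows "\<exists>\<delta>>0. \<forall>\<^sub>F (n, \<omega>) in whp M. \<forall>k. 1 \<le> k \<and> k < n \<and> \<epsilon> * real n \<le> real k \<longrightarrow> \<delta> < KS_distance X n k \<omega>"
proof -
  \<comment> \<open>The filter of triples \<open>(k, n, \<omega>)\<close>: eventually along it means with high probability, for all admissible \<open>k\<close> at once.\<close>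
  define \<H> where "\<H> = inf (filtercomap (\<lambda>(k, n, \<omega>). (n, \<omega>)) (whp M))
      (principal {(k, n, \<omega>). 1 \<le> k \<and> k < n \<and> \<epsilon> * real n \<le> real k})"
  have ev_H: "eventually P \<H> \<longleftrightarrow>
      (\<forall>\<^sub>F (n, \<omega>) in whp M. \<forall>k. 1 \<le> k \<and> k < n \<and> \<epsilon> * real n \<le> real k \<longrightarrow> P (k, n, \<omega>))" for P
    unfolding \<H>_def eventually_inf_principal eventually_filtercomap
    by (auto simp: case_prod_unfold elim!: eventually_mono intro: exI)
  define T where "T = (\<lambda>(k, n, \<omega>). order_stat X n (n - k) \<omega>)"
  obtain B where B: "tail F B < \<epsilon>" 
    using order_tendstoD(2)[OF tail_tendsto_0 \<epsilon>] by (auto simp: eventually_at_top_linorder)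
  have "\<forall>\<^sub>F z in \<H>. T z \<in> {1..B}"
    unfolding ev_H using whp_sample_ge_left_endpoint order_tendstoD(2)[OF empirical_tail_tendsto B]
  proof eventually_elim
    case (elim z)
    show ?case
    proof (cases z)
      case (Pair n \<omega>)
      have "T (k, n, \<omega>) \<in> {1..B}" if k: "1 \<le> k" "k < n" "\<epsilon> * real n \<le> real k" for k
      proof -
        have "left_endpoint \<le> T (k, n, \<omega>)"
          unfolding T_def prod.case using elim(1) Pair k by (intro order_stat_ge) simp_all
        moreover have "\<epsilon> \<le> real k / real n" using k by (simp add: field_simps)
        then have "\<not> B < T (k, n, \<omega>)"
          using order_stat_threshold(1)[OF k(1,2), of B X \<omega>] elim(2) Pair by (auto simp: T_def)
        ultimately show ?thesis using left_endpoint_ge_1 by simp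
      qed
      then show ?thesis using Pair by simp
    qed
  qed
  moreover have "\<exists>\<delta>>0. \<forall>\<^sub>F z in inf \<H> (filtercomap T (nhds x)). \<delta> < (case z of (k, n, \<omega>) \<Rightarrow> KS_distance X n k \<omega>)"
    if "x \<in> {1..B}" for x
  proof -
    let ?\<H> = "inf \<H> (filtercomap T (nhds x))"
    have pos: "0 < limit_distance \<alpha> F x" using that by (intro limit_distance_pos[OF not_pareto]) auto
    have "((\<lambda>z. KS_distance X (fst (snd z)) (fst z) (snd (snd z))) \<longlongrightarrow> limit_distance \<alpha> F x) ?\<H>"
    proof (rule KS_distance_tendsto[where N = "\<lambda>z. fst (snd z)" and W = "\<lambda>z. snd (snd z)" and K = fst])
      have "?\<H> \<le> filtercomap (\<lambda>(k, n, \<omega>). (n, \<omega>)) (whp M)"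
        unfolding \<H>_def by (simp add: le_infI1)
      then show "filterlim (\<lambda>z. (fst (snd z), snd (snd z))) (whp M) ?\<H>"
        unfolding filterlim_iff_le_filtercomap by (simp add: case_prod_unfold)
      have "\<forall>\<^sub>F z in \<H>. 1 \<le> fst z \<and> fst z < fst (snd z)"
        unfolding ev_H by (intro always_eventually) auto
      then show "\<forall>\<^sub>F z in ?\<H>. 1 \<le> fst z \<and> fst z < fst (snd z)"
        by (rule filter_leD[rotated]) simp
      have "filterlim T (nhds x) ?\<H>" unfolding filterlim_iff_le_filtercomap by simp
      then show "((\<lambda>z. order_stat X (fst (snd z)) (fst (snd z) - fst z) (snd (snd z))) \<longlongrightarrow> x) ?\<H>"
        by (simp add: T_def case_prod_unfold)
    qed (use that in auto)
    from order_tendstoD(1)[OF this, of "limit_distance \<alpha> F x / 2"] show ?thesis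
      using pos by (intro exI[of _ "limit_distance \<alpha> F x / 2"]) (simp add: case_prod_unfold)
  qed
  ultimately have "\<exists>\<delta>>0. \<forall>\<^sub>F z in \<H>. \<delta> < (case z of (k, n, \<omega>) \<Rightarrow> KS_distance X n k \<omega>)"
    by (intro compact_eventually_lower_bound[where K = "{1..B}"]) auto
  then show ?thesis unfolding ev_H by simp
qed

text \<open>
  Any index of at least \<open>\<epsilon> n\<close> has a distance above a fixed \<open>\<delta>\<close>, but some index \<open>[G(x) n]\<close> with large \<open>x\<close> has one
  below \<open>\<delta>\<close>.
\<close>
theorem KS_argmin_ratio_tendsto_0:
  assumes not_pareto: "\<not> eventually_pareto \<alpha> F"
  shows "((\<lambda>(n, \<omega>). real (KS_argmin X n \<omega>) / real n) \<longlongrightarrow> 0) (whp M)"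
proof (rule tendstoI)
  fix \<epsilon> :: real assume \<epsilon>: "0 < \<epsilon>"
  obtain \<delta> where \<delta>: "0 < \<delta>"
      "\<forall>\<^sub>F (n, \<omega>) in whp M. \<forall>k. 1 \<le> k \<and> k < n \<and> \<epsilon> * real n \<le> real k \<longrightarrow> \<delta> < KS_distance X n k \<omega>"
    using KS_distance_bounded_below[OF not_pareto \<epsilon>] by blast
  have "\<forall>\<^sub>F x in at_top. limit_distance \<alpha> F x < \<delta> \<and> left_endpoint \<le> x"
    using order_tendstoD(2)[OF limit_distance_tendsto_0 \<delta>(1)] eventually_ge_at_top by (rule eventually_conj)
  then obtain x where x: "limit_distance \<alpha> F x < \<delta>" "left_endpoint \<le> x"
    using eventually_happens' trivial_limit_at_top_linorder by blast
  show "\<forall>\<^sub>F z in whp M. dist (case z of (n, \<omega>) \<Rightarrow> real (KS_argmin X n \<omega>) / real n) 0 < \<epsilon>"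
    using \<delta>(2) order_tendstoD(2)[OF KS_distance_tail_index_tendsto[OF x(2)] x(1)]
      eventually_whp_of_sequentially[OF tail_index_eventually_valid[of x], of M]
  proof eventually_elim
    case (elim z)
    obtain n \<omega> where z: "z = (n, \<omega>)" by (cases z)
    let ?\<kappa> = "KS_argmin X n \<omega>"
    have idx: "1 \<le> tail_index F x n" "tail_index F x n < n" using elim(3) z by auto
    have \<kappa>: "?\<kappa> \<in> {1..n - 1}" using idx by (intro KS_argmin_bounds(1)) simp
    have "KS_distance X n ?\<kappa> \<omega> \<le> KS_distance X n (tail_index F x n) \<omega>"
      using idx by (intro KS_argmin_bounds(2)) auto
    also have "\<dots> < \<delta>" using elim(2) z by simp
    finally have "\<not> \<epsilon> * real n \<le> real ?\<kappa>" using elim(1) \<kappa> z by force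
    then show ?case using idx z by (simp add: field_simps)
  qed
qed

end

theorem theorem2p6:
  fixes M :: "'a measure" and X :: "nat \<Rightarrow> 'a \<Rightarrow> real"
    and \<nu> :: "real measure" and F :: "real \<Rightarrow> real" and \<alpha> :: real
  assumes "\<alpha> > 0"
    and "real_distribution \<nu>" and "F = cdf \<nu>"
    and "measure \<nu> {1..} = 1"
    and "continuous_on UNIV F"
    and "regularly_varying (tail F) (-\<alpha>)"
    and "continuous_on UNIV (tail F)"
    and "continuous_on {0..<1} (quantile F)"
    and "prob_space M"
    and "prob_space.indep_vars M (\<lambda>_. borel) X {1..}"
    and "\<And>i. i \<ge> 1 \<Longrightarrow> distr M borel (X i) = \<nu>"
  shows "(\<forall>x\<ge>quantile F 0.
            tendsto_in_prob M (\<lambda>n. KS_distance X n (tail_index F x n)) (limit_distance \<alpha> F x))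
       \<and> (\<not> eventually_pareto \<alpha> F \<longrightarrow> (\<forall>x\<ge>1. limit_distance \<alpha> F x > 0))
       \<and> (\<not> eventually_pareto \<alpha> F \<longrightarrow>
            tendsto_in_prob M (\<lambda>n \<omega>. real (KS_argmin X n \<omega>) / real n) 0)"
proof -
  interpret heavy_tailed_sample \<nu> F \<alpha> M X
    using assms unfolding heavy_tailed_sample_def heavy_tailed_sample_axioms_def
      heavy_tailed_law_def heavy_tailed_law_axioms_def by blast
  have KS: "KS_distance X n (tail_index F x n) \<in> borel_measurable M" for x n
    using tail_index_bounds(1)[of n x] by (intro borel_measurable_KS_distance X_measurable) auto
  have argmin: "(\<lambda>\<omega>. real (KS_argmin X n \<omega>) / real n) \<in> borel_measurable M" for n
    by (intro borel_measurable_KS_argmin X_measurable) auto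
  show ?thesis
    using KS_distance_tail_index_tendsto limit_distance_pos KS_argmin_ratio_tendsto_0
    by (simp add: tendsto_in_prob_iff_whp[OF assms(9) KS] tendsto_in_prob_iff_whp[OF assms(9) argmin])
qed

end
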